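(* Let $K$ be a subfield of $\mathbb{R}$, let $n\geq 2$ be an even integer and let $A\in\mathcal{M}_n(K)$. The following conditions are equivalent: (i) For every $X\in\mathcal{M}_n(K)$, $\det(AX+XA)\geq 0$. (ii) Either $\mathrm{rank}(A)<\dfrac{n}{2}$, or there exists $\alpha\in K$ with $\alpha\leq 0$ such that $A^2=\alpha I_n$.
   Context: $\mathcal{M}_n(K)$ denotes the set of $n\times n$ matrices with entries in $K$, and $I_n$ is the identity matrix. The order on $K$ is the one induced from $\mathbb{R}$. *)

theory Defs
  imports
    Complex_Main
    "HOL-Algebra.Subrings"
    "Jordan_Normal_Form.Determinant"
    "Jordan_Normal_Form.DL_Rank"
begin

(* Matrices over a subfield K of the reals are kept as real matrices.  Their determinant
   is therefore literally the same number, and their rank over the reals is the rank over K,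
   since rank is invariant under field extension. *)
definition mats_over :: "nat \<Rightarrow> real set \<Rightarrow> real mat set" where
  "mats_over n K = {A \<in> carrier_mat n n. elements_mat A \<subseteq> K}"

end

theory Submission
  imports Defs
begin

text \<open>
  Write \<open>f X = det (A * X + X * A)\<close>.

  If \<open>A\<close> factors through a space of dimension less than \<open>n / 2\<close>, then \<open>A * X + X * A\<close> factors through
  one of dimension less than \<open>n\<close>. If \<open>A\<^sup>2 = \<alpha> I\<close> with \<open>\<alpha> < 0\<close>, then \<open>M = A * X + X * A\<close> commutes with
  the complex structure \<open>J = A / sqrt (- \<alpha>)\<close>, and the complementary idempotents \<open>E = (1 - \<i> J) / 2\<close>
  and its conjugate \<open>F\<close> give \<open>M = (M E + F) (E + M F)\<close>, so that \<open>det M = |det (M E + F)|\<^sup>2\<close>.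
  If \<open>A\<^sup>2 = 0\<close> and \<open>f X \<noteq> 0\<close>, then \<open>A\<close> is a limit of matrices whose squares are negative scalars.

  Conversely, \<open>K\<close> is dense, so \<open>f\<close> is nonnegative on all real matrices. When \<open>2 rank A \<ge> n\<close>, a
  suitable conjugate \<open>B\<close> of \<open>A\<close> satisfies \<open>ker B \<inter> ker B\<^sup>T = 0\<close>, so that \<open>B B\<^sup>T + B\<^sup>T B\<close> is positive
  definite; hence \<open>f X \<noteq> 0\<close> for some \<open>X\<close>. Put \<open>M = A X + X A\<close> and \<open>N = M\<^sup>-\<^sup>1\<close>. Along the line
  \<open>X + t u v\<^sup>T\<close> the function \<open>f\<close> is a quadratic polynomial in \<open>t\<close>; its discriminant is nonpositive, i.e.
  \<open>(v\<^sup>T N A u - v\<^sup>T A N u)\<^sup>2 + 4 (v\<^sup>T N u) (v\<^sup>T A N A u) \<le> 0\<close> for all \<open>u, v\<close>. Vectors with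
  \<open>v\<^sup>T N u = 0\<close> show that \<open>N A M - A\<close> is scalar, hence zero by taking traces; the inequality then
  becomes \<open>(v\<^sup>T w) (v\<^sup>T A\<^sup>2 w) \<le> 0\<close> with \<open>w = N u\<close> arbitrary, which forces \<open>A\<^sup>2\<close> to be a nonpositive scalar.
\<close>

section \<open>Rank factorizations\<close>

text \<open>Padding \<open>Z\<close> with zero rows to size \<open>n\<close> leaves row
  \<open>k\<close> zero, so the square matrix \<open>Z'\<close> is singular, and a kernel vector of
  \<open>Z'\<close> is also one of \<open>Z\<close>.\<close>

lemma wide_mat_kernel:
  fixes Z :: "'a::field mat"
  assumes Z: "Z \<in> carrier_mat k n" and kn: "k < n"
  obtains y where "y \<in> carrier_vec n" "y \<noteq> 0\<^sub>v n" "Z *\<^sub>v y = 0\<^sub>v k"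
proof -
  define Z' where "Z' = mat n n (\<lambda>(i,j). if i < k then Z $$ (i,j) else 0)"
  have Z': "Z' \<in> carrier_mat n n" by (simp add: Z'_def)
  have "Z'\<^sup>T *\<^sub>v unit_vec n k = 0\<^sub>v n"
    using kn by (intro eq_vecI) (auto simp: Z'_def)
  moreover have "unit_vec n k \<noteq> (0\<^sub>v n :: 'a vec)" using kn by auto
  ultimately have "det (Z'\<^sup>T) = 0"
    using det_0_iff_vec_prod_zero_field[of "Z'\<^sup>T" n] Z' by (metis transpose_carrier_mat unit_vec_carrier)
  then have "det Z' = 0" using det_transpose[OF Z'] by simp
  then obtain y where y: "y \<in> carrier_vec n" "y \<noteq> 0\<^sub>v n" "Z' *\<^sub>v y = 0\<^sub>v n"
    using det_0_iff_vec_prod_zero_field[OF Z'] by blast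
  have "Z *\<^sub>v y = 0\<^sub>v k"
  proof (rule eq_vecI)
    fix i assume i: "i < dim_vec (0\<^sub>v k :: 'a vec)"
    then have "row Z i = row Z' i" using Z kn by (intro eq_vecI) (auto simp: Z'_def)
    then have "(Z *\<^sub>v y) $ i = (Z' *\<^sub>v y) $ i" using i Z Z' kn by auto
    then show "(Z *\<^sub>v y) $ i = 0\<^sub>v k $ i" using y i kn by simp
  qed (use Z in simp)
  with y that show ?thesis by blast
qed

text \<open>Dimension comparison without dimensions: writing each column of \<open>U\<close> through
  \<open>V\<close> gives \<open>U = V * Z\<close>, and if \<open>k < r\<close> a kernel vector of
  the wide matrix \<open>Z\<close> contradicts injectivity of \<open>U\<close>.\<close>

lemma injective_cols_le:
  fixes U :: "'a::field mat"
  assumes U: "U \<in> carrier_mat n r" and V: "V \<in> carrier_mat n k"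
    and inj: "\<And>y. y \<in> carrier_vec r \<Longrightarrow> U *\<^sub>v y = 0\<^sub>v n \<Longrightarrow> y = 0\<^sub>v r"
    and im: "\<And>y. y \<in> carrier_vec r \<Longrightarrow> \<exists>z\<in>carrier_vec k. U *\<^sub>v y = V *\<^sub>v z"
  shows "r \<le> k"
proof (rule ccontr)
  assume "\<not> r \<le> k"
  then have kr: "k < r" by simp
  have "\<forall>j. \<exists>z\<in>carrier_vec k. U *\<^sub>v unit_vec r j = V *\<^sub>v z" using im by simp
  then obtain f where f: "\<And>j. f j \<in> carrier_vec k" "\<And>j. U *\<^sub>v unit_vec r j = V *\<^sub>v f j"
    by metis
  define Z where "Z = mat k r (\<lambda>(i,j). f j $ i)"
  have Z: "Z \<in> carrier_mat k r" by (simp add: Z_def)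
  have "U = V * Z"
  proof (rule eq_matI)
    fix i j assume ij: "i < dim_row (V * Z)" "j < dim_col (V * Z)"
    then have i: "i < n" and j: "j < r" using V Z by auto
    have "col Z j = f j" using f(1)[of j] j by (intro eq_vecI) (auto simp: Z_def)
    then have "(V * Z) $$ (i,j) = (V *\<^sub>v f j) $ i" using i j V Z by simp
    also have "\<dots> = (U *\<^sub>v unit_vec r j) $ i" using f(2) by simp
    also have "\<dots> = U $$ (i,j)" using i j U by simp
    finally show "U $$ (i,j) = (V * Z) $$ (i,j)" by simp
  qed (use U V Z in auto)
  moreover obtain y where y: "y \<in> carrier_vec r" "y \<noteq> 0\<^sub>v r" "Z *\<^sub>v y = 0\<^sub>v k"
    using wide_mat_kernel[OF Z kr] by blast
  ultimately have "U *\<^sub>v y = V *\<^sub>v 0\<^sub>v k" using V Z by simp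
  then have "U *\<^sub>v y = 0\<^sub>v n" using V by auto
  with inj y show False by blast
qed

text \<open>\<open>U\<close> collects a maximal independent set of columns of \<open>A\<close>,
  \<open>C\<close> holds the coordinates of all columns in it, and \<open>D\<close> selects the
  chosen columns. \<open>A = U * C\<close> serves the low rank case; \<open>U = A * D\<close>
  exhibits a basis of the range of \<open>A\<close> in the high rank case.\<close>

lemma (in vec_space) rank_factorization:
  assumes A: "A \<in> carrier_mat n nc"
  obtains U C D where "U \<in> carrier_mat n (rank A)" "C \<in> carrier_mat (rank A) nc"
    "D \<in> carrier_mat nc (rank A)" "A = U * C" "U = A * D"
    "\<And>y. y \<in> carrier_vec (rank A) \<Longrightarrow> U *\<^sub>v y = 0\<^sub>v n \<Longrightarrow> y = 0\<^sub>v (rank A)"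
proof -
  let ?r = "rank A"
  obtain S where S: "maximal S (\<lambda>T. T \<subseteq> set (cols A) \<and> lin_indpt T)"
    using maximal_exists[of "(\<lambda>T. T \<subseteq> set (cols A) \<and> lin_indpt T)" "card (set (cols A))" "{}"]
    by (meson List.finite_set card_mono empty_iff empty_subsetI finite_lin_indpt2 rev_finite_subset)
  then have SA: "S \<subseteq> set (cols A)" and li: "lin_indpt S" by (auto simp: maximal_def)
  have colsA: "set (cols A) \<subseteq> carrier_vec n" using A cols_dim by blast
  obtain us where us: "set us = S" "distinct us"
    using SA finite_distinct_list finite_subset by (metis List.finite_set)
  have r: "?r = length us"
    using rank_card_indpt[OF A S] us distinct_card by fastforce
  define U where "U = mat_of_cols n us"
  have U: "U \<in> carrier_mat n ?r" by (simp add: U_def r)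
  have colsU: "cols U = us" using SA colsA us by (auto simp: U_def)
  have colU: "col U j \<in> set (cols A)" if "j < ?r" for j
    using that SA us colsU U by (metis carrier_matD(2) cols_length cols_nth nth_mem subsetD)
  have inj: "y = 0\<^sub>v ?r" if "y \<in> carrier_vec ?r" "U *\<^sub>v y = 0\<^sub>v n" for y
    using lin_depI[OF U that(1) _ that(2)] colsU us li by auto
  \<comment> \<open>A column outside the span of \<open>S\<close> could be added to
    \<open>S\<close>, against maximality.\<close>
  have sp: "\<exists>z\<in>carrier_vec ?r. x = U *\<^sub>v z" if x: "x \<in> set (cols A)" for x
  proof -
    have "x \<in> span S"
    proof (rule ccontr)
      assume n: "x \<notin> span S"
      then have "x \<notin> S" using SA colsA span_mem by auto
      moreover have "lin_indpt (S \<union> {x})"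
        using lin_dep_iff_in_span[of S x] SA colsA li n x \<open>x \<notin> S\<close> by (auto simp: subset_iff)
      ultimately show False using S SA x unfolding maximal_def by blast
    qed
    then obtain a where "x = lincomb a S"
      using finite_in_span[of S x] SA colsA us by (metis List.finite_set carrier_vs_is_self dual_order.trans module_vec_simps(3))
    then have "x = U *\<^sub>v vec ?r (\<lambda>i. a (col U i))"
      using mat_mult_eq_lincomb[OF U, of a] colsU us by simp
    then show ?thesis by (intro bexI[of _ "vec ?r (\<lambda>i. a (col U i))"]) auto
  qed
  have "\<forall>j<nc. \<exists>z\<in>carrier_vec ?r. col A j = U *\<^sub>v z"
    using sp A by (metis carrier_matD(2) cols_length cols_nth nth_mem)
  then obtain f where f: "\<And>j. j < nc \<Longrightarrow> f j \<in> carrier_vec ?r" "\<And>j. j < nc \<Longrightarrow> col A j = U *\<^sub>v f j"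
    by metis
  define C where "C = mat ?r nc (\<lambda>(i,j). f j $ i)"
  have C: "C \<in> carrier_mat ?r nc" by (simp add: C_def)
  have AUC: "A = U * C"
  proof (rule mat_col_eqI)
    fix j assume "j < dim_col (U * C)"
    then have j: "j < nc" using C by simp
    then have "col C j = f j" using f(1)[OF j] by (intro eq_vecI) (auto simp: C_def)
    then show "col A j = col (U * C) j" using f(2)[OF j] j U C by (simp add: mult_mat_vec_def)
  qed (use A U C in auto)
  have "\<forall>j<?r. \<exists>l<nc. col U j = col A l"
    using colU A by (metis carrier_matD(2) cols_length cols_nth in_set_conv_nth)
  then obtain g where g: "\<And>j. j < ?r \<Longrightarrow> g j < nc" "\<And>j. j < ?r \<Longrightarrow> col U j = col A (g j)"
    by metis
  define D where "D = mat nc ?r (\<lambda>(i,j). if i = g j then 1 else 0 :: 'a)"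
  have D: "D \<in> carrier_mat nc ?r" by (simp add: D_def)
  have "U = A * D"
  proof (rule mat_col_eqI)
    fix j assume "j < dim_col (A * D)"
    then have j: "j < ?r" using D by simp
    then have "col D j = unit_vec nc (g j)" by (intro eq_vecI) (auto simp: D_def unit_vec_def)
    moreover have "A *\<^sub>v unit_vec nc (g j) = col A (g j)"
      using A g(1)[OF j] by (intro eq_vecI) auto
    ultimately show "col U j = col (A * D) j" using g(2)[OF j] j A D by (auto simp: mult_mat_vec_def)
  qed (use A U D in auto)
  then show ?thesis using that[OF U C D AUC _ inj] by blast
qed

text \<open>Stacking \<open>C\<close> on \<open>C * X\<close> gives \<open>2 * r < n\<close> rows,
  so some nonzero \<open>y\<close> satisfies both \<open>C y = 0\<close> and
  \<open>C X y = 0\<close>; each summand of the anticommutator kills it.\<close>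

lemma det_mult_add_mult_eq_0:
  fixes U :: "'a::field mat"
  assumes U: "U \<in> carrier_mat n r" and C: "C \<in> carrier_mat r n" and X: "X \<in> carrier_mat n n"
    and rn: "2 * r < n"
  shows "det (U * C * X + X * (U * C)) = 0"
proof -
  define T where "T = mat (r + r) n (\<lambda>(i,j). if i < r then C $$ (i,j) else (C * X) $$ (i - r,j))"
  have T: "T \<in> carrier_mat (r + r) n" by (simp add: T_def)
  obtain y where y: "y \<in> carrier_vec n" "y \<noteq> 0\<^sub>v n" "T *\<^sub>v y = 0\<^sub>v (r + r)"
    using wide_mat_kernel[OF T] rn by auto
  have "C *\<^sub>v y = 0\<^sub>v r"
  proof (rule eq_vecI)
    fix i assume "i < dim_vec (0\<^sub>v r :: 'a vec)"
    then have i: "i < r" by simp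
    then have "row T i = row C i" using C by (intro eq_vecI) (auto simp: T_def)
    then have "(C *\<^sub>v y) $ i = (T *\<^sub>v y) $ i" using i C T by simp
    then show "(C *\<^sub>v y) $ i = 0\<^sub>v r $ i" using y i by simp
  qed (use C in simp)
  moreover have "C *\<^sub>v (X *\<^sub>v y) = 0\<^sub>v r"
  proof (rule eq_vecI)
    fix i assume "i < dim_vec (0\<^sub>v r :: 'a vec)"
    then have i: "i < r" by simp
    then have "row T (i + r) = row (C * X) i" using C X
      by (intro eq_vecI) (auto simp: T_def)
    then have "((C * X) *\<^sub>v y) $ i = (T *\<^sub>v y) $ (i + r)" using i C X T by simp
    then show "(C *\<^sub>v (X *\<^sub>v y)) $ i = 0\<^sub>v r $ i" using y i C X by simp
  qed (use C in simp)
  ultimately have "(U * C * X + X * (U * C)) *\<^sub>v y = U *\<^sub>v 0\<^sub>v r + X *\<^sub>v (U *\<^sub>v 0\<^sub>v r)"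
    using U C X y(1) by (simp add: add_mult_distrib_mat_vec[of _ n n] assoc_mult_mat_vec[of U n r "C * X" n]
      assoc_mult_mat_vec[of C r n X n] assoc_mult_mat_vec[of X n n "U * C" n] assoc_mult_mat_vec[of U n r C n])
  also have "U *\<^sub>v 0\<^sub>v r = 0\<^sub>v n" using U by auto
  also have "0\<^sub>v n + X *\<^sub>v 0\<^sub>v n = 0\<^sub>v n" using X by auto
  finally show ?thesis
    using det_0_iff_vec_prod_zero_field[of "U * C * X + X * (U * C)" n] U C X y by auto
qed

lemma (in vec_space) det_anticommutator_low_rank:
  assumes A: "A \<in> carrier_mat n n" and X: "X \<in> carrier_mat n n" and r: "2 * rank A < n"
  shows "det (A * X + X * A) = 0"
proof -
  obtain U C where "U \<in> carrier_mat n (rank A)" "C \<in> carrier_mat (rank A) n" "A = U * C"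
    using rank_factorization[OF A] by metis
  then show ?thesis using det_mult_add_mult_eq_0[of U n "rank A" C X] X r by simp
qed

section \<open>Extending a basis of the range of \<open>A\<close> column by column\<close>

lemma mult_snoc_col:
  fixes S :: "'a::field mat"
  assumes S: "S \<in> carrier_mat n k" and c: "c \<in> carrier_vec n" and y: "y \<in> carrier_vec (Suc k)"
  shows "mat n (Suc k) (\<lambda>(i,j). if j < k then S $$ (i,j) else c $ i) *\<^sub>v y
    = S *\<^sub>v vec k (($) y) + y $ k \<cdot>\<^sub>v c"
  using assms by (intro eq_vecI) (auto simp: scalar_prod_def mult.commute)

lemma smult_inverse_cancel_vec:
  fixes c :: "'a::field vec"
  assumes "c \<in> carrier_vec n" "w \<in> carrier_vec n" "a \<noteq> 0" "w + a \<cdot>\<^sub>v c = 0\<^sub>v n"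
  shows "c = - (1 / a) \<cdot>\<^sub>v w"
proof (rule eq_vecI)
  fix i assume "i < dim_vec (- (1 / a) \<cdot>\<^sub>v w)"
  then have i: "i < n" using assms by simp
  then have "(w + a \<cdot>\<^sub>v c) $ i = 0" using arg_cong[OF assms(4), of "\<lambda>v. v $ i"] by simp
  then have "w $ i + a * c $ i = 0" using i assms(1,2) by simp
  then have "a * c $ i = - w $ i" by (simp add: add_eq_0_iff)
  then show "c $ i = (- (1 / a) \<cdot>\<^sub>v w) $ i" using i assms by (simp add: field_simps)
qed (use assms in simp)

text \<open>The vector \<open>c\<close> has to avoid two proper subspaces; if \<open>a\<close> avoids the first and \<open>b\<close> the second,
  then one of \<open>a\<close>, \<open>b\<close>, \<open>a + b\<close> avoids both.\<close>

lemma exists_complement_column: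
  fixes A :: "'a::field mat"
  assumes A: "A \<in> carrier_mat n n" and D: "D \<in> carrier_mat n r"
    and inj: "\<And>y. y \<in> carrier_vec r \<Longrightarrow> (A * D) *\<^sub>v y = 0\<^sub>v n \<Longrightarrow> y = 0\<^sub>v r"
    and S: "S \<in> carrier_mat n k" and k: "k < n" "k < 2 * r" "r \<le> k"
  obtains c where "c \<in> carrier_vec n" "\<And>y. y \<in> carrier_vec k \<Longrightarrow> S *\<^sub>v y \<noteq> c"
    "\<And>y. y \<in> carrier_vec k \<Longrightarrow> (\<And>i. i < r \<Longrightarrow> y $ i = 0) \<Longrightarrow> A *\<^sub>v (S *\<^sub>v y) \<noteq> A *\<^sub>v c"
proof -
  have "\<exists>a\<in>carrier_vec n. \<forall>y\<in>carrier_vec k. S *\<^sub>v y \<noteq> a"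
  proof (rule ccontr)
    assume "\<not> ?thesis"
    then have "\<And>y. y \<in> carrier_vec n \<Longrightarrow> \<exists>z\<in>carrier_vec k. 1\<^sub>m n *\<^sub>v y = S *\<^sub>v z" by fastforce
    then have "n \<le> k" using injective_cols_le[of "1\<^sub>m n :: 'a mat" n n S k] S by simp
    with k show False by simp
  qed
  then obtain a where a: "a \<in> carrier_vec n" "\<And>y. y \<in> carrier_vec k \<Longrightarrow> S *\<^sub>v y \<noteq> a" by blast
  have "\<exists>b\<in>carrier_vec n. \<forall>y\<in>carrier_vec k. (\<forall>i<r. y $ i = 0) \<longrightarrow> A *\<^sub>v (S *\<^sub>v y) \<noteq> A *\<^sub>v b"
  proof (rule ccontr)
    assume neg: "\<not> ?thesis"
    define W where "W = A * S"
    have W: "W \<in> carrier_mat n k" using A S by (simp add: W_def)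
    \<comment> \<open>\<open>V\<close> drops the first \<open>r\<close> columns of
      \<open>A * S\<close>, which do not matter for vectors whose first \<open>r\<close> entries
      vanish. If these vectors already filled the range of \<open>A\<close>, then
      \<open>r <= k - r\<close>, against \<open>k < 2 * r\<close>.\<close>
    define V where "V = mat n (k - r) (\<lambda>(i,j). W $$ (i,j + r))"
    have V: "V \<in> carrier_mat n (k - r)" by (simp add: V_def)
    have Vmult: "A *\<^sub>v (S *\<^sub>v y) = V *\<^sub>v vec (k - r) (\<lambda>i. y $ (i + r))"
      if y: "y \<in> carrier_vec k" "\<And>i. i < r \<Longrightarrow> y $ i = 0" for y
    proof -
      have "A *\<^sub>v (S *\<^sub>v y) = W *\<^sub>v y" using A S y by (simp add: W_def)
      also have "\<dots> = V *\<^sub>v vec (k - r) (\<lambda>i. y $ (i + r))"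
      proof (rule eq_vecI)
        fix i assume "i < dim_vec (V *\<^sub>v vec (k - r) (\<lambda>i. y $ (i + r)))"
        then have i: "i < n" using V by simp
        have "(W *\<^sub>v y) $ i = (\<Sum>j\<in>{0..<k}. W $$ (i,j) * y $ j)"
          using W y i by (auto simp: scalar_prod_def)
        also have "\<dots> = (\<Sum>j\<in>{r..<k}. W $$ (i,j) * y $ j)"
          using y by (intro sum.mono_neutral_right) auto
        also have "\<dots> = (\<Sum>j\<in>{0..<k-r}. W $$ (i,j + r) * y $ (j + r))"
          using sum.shift_bounds_nat_ivl[of "\<lambda>j. W $$ (i,j) * y $ j" 0 r "k - r"] k by simp
        also have "\<dots> = (V *\<^sub>v vec (k - r) (\<lambda>i. y $ (i + r))) $ i"
          using i by (simp add: V_def scalar_prod_def)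
        finally show "(W *\<^sub>v y) $ i = (V *\<^sub>v vec (k - r) (\<lambda>i. y $ (i + r))) $ i" .
      qed (use W V in auto)
      finally show ?thesis .
    qed
    have "\<exists>z\<in>carrier_vec (k - r). (A * D) *\<^sub>v x = V *\<^sub>v z" if x: "x \<in> carrier_vec r" for x
    proof -
      have "D *\<^sub>v x \<in> carrier_vec n" using D x by simp
      then obtain y where y: "y \<in> carrier_vec k" "\<forall>i<r. y $ i = 0" "A *\<^sub>v (S *\<^sub>v y) = A *\<^sub>v (D *\<^sub>v x)"
        using neg by blast
      then have "(A * D) *\<^sub>v x = V *\<^sub>v vec (k - r) (\<lambda>i. y $ (i + r))"
        using Vmult[of y] A D x by simp
      then show ?thesis by (intro bexI[of _ "vec (k - r) (\<lambda>i. y $ (i + r))"]) auto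
    qed
    then have "r \<le> k - r" using injective_cols_le[of "A * D" n r V "k - r"] A D V inj by auto
    with k show False by simp
  qed
  then obtain b where b: "b \<in> carrier_vec n"
    "\<And>y. y \<in> carrier_vec k \<Longrightarrow> (\<And>i. i < r \<Longrightarrow> y $ i = 0) \<Longrightarrow> A *\<^sub>v (S *\<^sub>v y) \<noteq> A *\<^sub>v b"
    by blast
  consider "\<And>y. y \<in> carrier_vec k \<Longrightarrow> (\<And>i. i < r \<Longrightarrow> y $ i = 0) \<Longrightarrow> A *\<^sub>v (S *\<^sub>v y) \<noteq> A *\<^sub>v a"
    | "\<And>y. y \<in> carrier_vec k \<Longrightarrow> S *\<^sub>v y \<noteq> b"
    | y0 y1 where "y0 \<in> carrier_vec k" "\<And>i. i < r \<Longrightarrow> y0 $ i = 0" "A *\<^sub>v (S *\<^sub>v y0) = A *\<^sub>v a"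
      "y1 \<in> carrier_vec k" "S *\<^sub>v y1 = b"
    by blast
  then show ?thesis
  proof cases
    case 1 then show ?thesis using that[of a] a by blast
  next
    case 2 then show ?thesis using that[of b] b by blast
  next
    case 3
    show ?thesis
    proof (rule that[of "a + b"])
      show "a + b \<in> carrier_vec n" using a b by simp
    next
      fix y :: "'a vec" assume y: "y \<in> carrier_vec k"
      \<comment> \<open>Subtracting \<open>y1\<close>, which represents \<open>b\<close>, reduces
        avoidance of \<open>a + b\<close> to that of \<open>a\<close>; below, subtracting
        \<open>y0\<close> reduces it to that of \<open>b\<close> in the same way.\<close>
      have "S *\<^sub>v (y - y1) \<noteq> a" using a y 3 by simp
      then show "S *\<^sub>v y \<noteq> a + b"
        using 3 y S a b by (auto simp: mult_minus_distrib_mat_vec[of _ n k])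
    next
      fix y :: "'a vec" assume y: "y \<in> carrier_vec k" "\<And>i. i < r \<Longrightarrow> y $ i = 0"
      have "A *\<^sub>v (S *\<^sub>v (y - y0)) \<noteq> A *\<^sub>v b" using b(2)[of "y - y0"] y 3 k by simp
      then have "A *\<^sub>v (S *\<^sub>v y) - A *\<^sub>v a \<noteq> A *\<^sub>v b"
        using 3 y S A a b by (simp add: mult_minus_distrib_mat_vec[of _ n k] mult_minus_distrib_mat_vec[of _ n n])
      then show "A *\<^sub>v (S *\<^sub>v y) \<noteq> A *\<^sub>v (a + b)"
        using A a b by (auto simp: mult_add_distrib_mat_vec[of _ n n])
    qed
  qed
qed

text \<open>The first \<open>r\<close> columns of \<open>S\<close> span the range of \<open>A\<close> when \<open>r\<close> is its rank, and the others span a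
  subspace on which \<open>A\<close> is injective.\<close>

lemma exists_adapted_basis:
  fixes A :: "'a::field mat"
  assumes A: "A \<in> carrier_mat n n" and D: "D \<in> carrier_mat n r"
    and inj: "\<And>y. y \<in> carrier_vec r \<Longrightarrow> (A * D) *\<^sub>v y = 0\<^sub>v n \<Longrightarrow> y = 0\<^sub>v r"
    and rn: "n \<le> 2 * r" and "r \<le> k" "k \<le> n"
  shows "\<exists>S\<in>carrier_mat n k. (\<forall>i<n. \<forall>j<r. S $$ (i,j) = (A * D) $$ (i,j)) \<and>
    (\<forall>y\<in>carrier_vec k. S *\<^sub>v y = 0\<^sub>v n \<longrightarrow> y = 0\<^sub>v k) \<and>
    (\<forall>y\<in>carrier_vec k. (\<forall>i<r. y $ i = 0) \<longrightarrow> A *\<^sub>v (S *\<^sub>v y) = 0\<^sub>v n \<longrightarrow> y = 0\<^sub>v k)"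
  using \<open>r \<le> k\<close> \<open>k \<le> n\<close>
proof (induction k rule: dec_induct)
  case base
  \<comment> \<open>For \<open>k = r\<close> the last clause holds because a vector of length
    \<open>r\<close> whose first \<open>r\<close> entries vanish is zero.\<close>
  show ?case using A D inj by (intro bexI[of _ "A * D"]) auto
next
  case (step k)
  then obtain S where S: "S \<in> carrier_mat n k"
    and SD: "\<forall>i<n. \<forall>j<r. S $$ (i,j) = (A * D) $$ (i,j)"
    and S0: "\<forall>y\<in>carrier_vec k. S *\<^sub>v y = 0\<^sub>v n \<longrightarrow> y = 0\<^sub>v k"
    and AS0: "\<forall>y\<in>carrier_vec k. (\<forall>i<r. y $ i = 0) \<longrightarrow> A *\<^sub>v (S *\<^sub>v y) = 0\<^sub>v n \<longrightarrow> y = 0\<^sub>v k"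
    by auto
  obtain c where c: "c \<in> carrier_vec n" "\<And>y. y \<in> carrier_vec k \<Longrightarrow> S *\<^sub>v y \<noteq> c"
    "\<And>y. y \<in> carrier_vec k \<Longrightarrow> (\<And>i. i < r \<Longrightarrow> y $ i = 0) \<Longrightarrow> A *\<^sub>v (S *\<^sub>v y) \<noteq> A *\<^sub>v c"
    using exists_complement_column[OF A D inj S] step rn by auto
  let ?S = "mat n (Suc k) (\<lambda>(i,j). if j < k then S $$ (i,j) else c $ i)"
  have zc: "0 \<cdot>\<^sub>v c = 0\<^sub>v n" "0 \<cdot>\<^sub>v (A *\<^sub>v c) = 0\<^sub>v n"
    using c(1) A by auto
  have ext: "y = 0\<^sub>v (Suc k)"
    if "y \<in> carrier_vec (Suc k)" "y $ k = 0" "vec k (($) y) = 0\<^sub>v k" for y :: "'a vec"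
  proof (rule eq_vecI)
    fix i assume i: "i < dim_vec (0\<^sub>v (Suc k) :: 'a vec)"
    show "y $ i = 0\<^sub>v (Suc k) $ i"
    proof (cases "i = k")
      case False
      then have "i < k" using i by simp
      then show ?thesis using arg_cong[OF that(3), of "\<lambda>v. v $ i"] by simp
    qed (use that in simp)
  qed (use that in simp)
  show ?case
  proof (intro bexI[of _ ?S] conjI allI ballI impI)
    fix y :: "'a vec" assume y: "y \<in> carrier_vec (Suc k)" and "?S *\<^sub>v y = 0\<^sub>v n"
    then have eq: "S *\<^sub>v vec k (($) y) + y $ k \<cdot>\<^sub>v c = 0\<^sub>v n"
      using mult_snoc_col[OF S c(1) y] by simp
    \<comment> \<open>Otherwise dividing by the last coefficient would put \<open>c\<close> into the
      image of \<open>S\<close>, which \<open>c\<close> was chosen to avoid. The same division is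
      used below for \<open>A *\<^sub>v c\<close>.\<close>
    have "y $ k = 0"
    proof (rule ccontr)
      assume "y $ k \<noteq> 0"
      then have "c = - (1 / y $ k) \<cdot>\<^sub>v (S *\<^sub>v vec k (($) y))"
        using smult_inverse_cancel_vec[OF c(1) _ _ eq] S by auto
      also have "\<dots> = S *\<^sub>v (- (1 / y $ k) \<cdot>\<^sub>v vec k (($) y))"
        using S by (simp add: mult_mat_vec[of _ n k])
      finally show False using c(2)[of "- (1 / y $ k) \<cdot>\<^sub>v vec k (($) y)"] by simp
    qed
    moreover from this have "S *\<^sub>v vec k (($) y) = 0\<^sub>v n" using eq c(1) S zc by simp
    ultimately show "y = 0\<^sub>v (Suc k)" using ext[OF y] S0 by simp
  next
    fix y :: "'a vec" assume y: "y \<in> carrier_vec (Suc k)" and y0: "\<forall>i<r. y $ i = 0"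
      and "A *\<^sub>v (?S *\<^sub>v y) = 0\<^sub>v n"
    then have eq: "A *\<^sub>v (S *\<^sub>v vec k (($) y)) + y $ k \<cdot>\<^sub>v (A *\<^sub>v c) = 0\<^sub>v n"
      using mult_snoc_col[OF S c(1) y] A c(1) S
      by (simp add: mult_add_distrib_mat_vec[of _ n n] mult_mat_vec[of _ n n])
    have y0': "\<And>i. i < r \<Longrightarrow> vec k (($) y) $ i = 0" using y0 step by simp
    have "y $ k = 0"
    proof (rule ccontr)
      assume "y $ k \<noteq> 0"
      then have "A *\<^sub>v c = - (1 / y $ k) \<cdot>\<^sub>v (A *\<^sub>v (S *\<^sub>v vec k (($) y)))"
        using smult_inverse_cancel_vec[OF _ _ _ eq] S A c(1) by auto
      also have "\<dots> = A *\<^sub>v (S *\<^sub>v (- (1 / y $ k) \<cdot>\<^sub>v vec k (($) y)))"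
        using S A by (simp add: mult_mat_vec[of _ n k] mult_mat_vec[of _ n n])
      finally show False using c(3)[of "- (1 / y $ k) \<cdot>\<^sub>v vec k (($) y)"] y0' step by simp
    qed
    moreover from this have "A *\<^sub>v (S *\<^sub>v vec k (($) y)) = 0\<^sub>v n" using eq c(1) S A zc by simp
    ultimately show "y = 0\<^sub>v (Suc k)" using ext[OF y] AS0 y0' by simp
  qed (use S SD step in auto)
qed

section \<open>A nonsingular anticommutator\<close>

lemma nonsingular_inverse:
  fixes S :: "'a::field mat"
  assumes S: "S \<in> carrier_mat n n" and "det S \<noteq> 0"
  obtains T where "T \<in> carrier_mat n n" "S * T = 1\<^sub>m n" "T * S = 1\<^sub>m n"
  using det_non_zero_imp_unit[OF S assms(2)]
  by (auto simp: Units_def ring_mat_def)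

lemma scalar_prod_self_nonneg: "0 \<le> (v :: real vec) \<bullet> v"
  by (simp add: scalar_prod_def sum_nonneg)

lemma scalar_prod_self_eq_0:
  assumes "v \<in> carrier_vec n" "(v :: real vec) \<bullet> v = 0"
  shows "v = 0\<^sub>v n"
proof -
  have "\<forall>i\<in>{0..<n}. v $ i * v $ i = 0"
    using assms by (subst sum_nonneg_eq_0_iff[symmetric]) (auto simp: scalar_prod_def)
  then show ?thesis using assms by (intro eq_vecI) auto
qed

text \<open>The quadratic form of this matrix at \<open>y\<close> is the sum of the squared lengths
  of \<open>B y\<close> and \<open>B\<^sup>T y\<close>, so a kernel vector lies in both
  kernels.\<close>

lemma det_gram_sum_ne_0:
  fixes B :: "real mat"
  assumes B: "B \<in> carrier_mat n n"
    and ker: "\<And>y. y \<in> carrier_vec n \<Longrightarrow> B *\<^sub>v y = 0\<^sub>v n \<Longrightarrow> B\<^sup>T *\<^sub>v y = 0\<^sub>v n \<Longrightarrow> y = 0\<^sub>v n"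
  shows "det (B * B\<^sup>T + B\<^sup>T * B) \<noteq> 0"
proof
  assume "det (B * B\<^sup>T + B\<^sup>T * B) = 0"
  then obtain y where y: "y \<in> carrier_vec n" "y \<noteq> 0\<^sub>v n" "(B * B\<^sup>T + B\<^sup>T * B) *\<^sub>v y = 0\<^sub>v n"
    using det_0_iff_vec_prod_zero_field[of "B * B\<^sup>T + B\<^sup>T * B" n] B by auto
  let ?p = "B *\<^sub>v y" and ?q = "B\<^sup>T *\<^sub>v y"
  have p: "?p \<in> carrier_vec n" and q: "?q \<in> carrier_vec n" using B y by auto
  have "(B * B\<^sup>T + B\<^sup>T * B) *\<^sub>v y = B *\<^sub>v ?q + B\<^sup>T *\<^sub>v ?p"
    using B y(1) by (simp add: add_mult_distrib_mat_vec[of _ n n])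
  then have "B *\<^sub>v ?q + B\<^sup>T *\<^sub>v ?p = 0\<^sub>v n" using y(3) by simp
  then have "0 = y \<bullet> (B *\<^sub>v ?q + B\<^sup>T *\<^sub>v ?p)" using y(1) by simp
  also have "\<dots> = y \<bullet> (B *\<^sub>v ?q) + y \<bullet> (B\<^sup>T *\<^sub>v ?p)"
    using B y p q by (intro scalar_prod_add_distrib) auto
  also have "y \<bullet> (B *\<^sub>v ?q) = ?q \<bullet> ?q"
    using transpose_vec_mult_scalar[OF B q y(1)] by simp
  also have "y \<bullet> (B\<^sup>T *\<^sub>v ?p) = ?p \<bullet> ?p"
    using transpose_vec_mult_scalar[of "B\<^sup>T" n n ?p y] B p y(1) by simp
  finally have "?q \<bullet> ?q = 0" "?p \<bullet> ?p = 0"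
    using scalar_prod_self_nonneg[of ?p] scalar_prod_self_nonneg[of ?q] by linarith+
  then show False using ker y scalar_prod_self_eq_0 p q by blast
qed

lemma det_conj_inverse:
  fixes S :: "'a::field mat"
  assumes "S \<in> carrier_mat n n" "T \<in> carrier_mat n n" "M \<in> carrier_mat n n" "S * T = 1\<^sub>m n" 
  shows "det (S * M * T) = det M"
proof -
  have "det S * det T = 1" using det_mult[OF assms(1,2)] assms(4) by simp
  then show ?thesis using assms by (simp add: det_mult[of _ n] del: assoc_mult_mat)
qed

text \<open>In the adapted basis \<open>S\<close>, the range of the conjugate \<open>B\<close>
  contains the first \<open>rank A\<close> unit vectors and \<open>B\<close> is injective on the
  span of the others. A vector killed by \<open>B\<^sup>T\<close> is orthogonal to the range of
  \<open>B\<close>, hence lies in that span; if \<open>B\<close> kills it too, it is zero.\<close>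

lemma exists_det_anticommutator_ne_0:
  fixes A :: "real mat"
  assumes A: "A \<in> carrier_mat n n" and rank: "n \<le> 2 * vec_space.rank n A"
  obtains X where "X \<in> carrier_mat n n" "det (A * X + X * A) \<noteq> 0"
proof -
  interpret vec_space "TYPE(real)" n .
  let ?r = "rank A"
  obtain D where D: "D \<in> carrier_mat n ?r"
    and inj: "\<And>y. y \<in> carrier_vec ?r \<Longrightarrow> (A * D) *\<^sub>v y = 0\<^sub>v n \<Longrightarrow> y = 0\<^sub>v ?r"
    using rank_factorization[OF A] by metis
  obtain S where S: "S \<in> carrier_mat n n"
    and SD: "\<forall>i<n. \<forall>j<?r. S $$ (i,j) = (A * D) $$ (i,j)"
    and S0: "\<forall>y\<in>carrier_vec n. S *\<^sub>v y = 0\<^sub>v n \<longrightarrow> y = 0\<^sub>v n"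
    and AS0: "\<forall>y\<in>carrier_vec n. (\<forall>i<?r. y $ i = 0) \<longrightarrow> A *\<^sub>v (S *\<^sub>v y) = 0\<^sub>v n \<longrightarrow> y = 0\<^sub>v n"
    using exists_adapted_basis[OF A D inj rank rank_le_nc[OF A] order_refl] by blast
  have "det S \<noteq> 0" using det_0_iff_vec_prod_zero_field[OF S] S0 by blast
  then obtain T where T: "T \<in> carrier_mat n n" "S * T = 1\<^sub>m n" "T * S = 1\<^sub>m n"
    using nonsingular_inverse[OF S] by blast
  define B where "B = T * A * S"
  have B: "B \<in> carrier_mat n n" using A S T by (simp add: B_def)
  have SBT: "A = S * B * T"
  proof -
    have "S * B * T = (S * T) * A * (S * T)" using A S T(1) by (simp add: B_def assoc_mult_mat[of _ n n _ n _ n])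
    then show ?thesis using A T by simp
  qed
  have "det (B * B\<^sup>T + B\<^sup>T * B) \<noteq> 0"
  proof (rule det_gram_sum_ne_0[OF B])
    fix y assume y: "y \<in> carrier_vec n" and By: "B *\<^sub>v y = 0\<^sub>v n" and BTy: "B\<^sup>T *\<^sub>v y = 0\<^sub>v n"
    show "y = 0\<^sub>v n"
    proof (rule AS0[rule_format, OF y])
      have "A *\<^sub>v (S *\<^sub>v y) = (S * B * T) *\<^sub>v (S *\<^sub>v y)" using SBT by simp
      also have "\<dots> = S *\<^sub>v (B *\<^sub>v ((T * S) *\<^sub>v y))" using S B T(1) y
        by (simp add: assoc_mult_mat_vec[of _ n n _ n])
      also have "\<dots> = 0\<^sub>v n" using T y By S by auto
      finally show "A *\<^sub>v (S *\<^sub>v y) = 0\<^sub>v n" .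
    next
      fix i assume i: "i < ?r"
      \<comment> \<open>Column \<open>i\<close> of \<open>A * D\<close> is column \<open>i\<close>
        of \<open>S\<close>, which \<open>T\<close> sends to the unit vector \<open>i\<close>; this
        identity therefore places that unit vector in the range of \<open>B\<close>.\<close>
      have "T * (A * D) = B * (T * D)"
      proof -
        have "B * (T * D) = T * (A * ((S * T) * D))"
          using A S T(1) D by (simp add: B_def assoc_mult_mat[of _ n n _ n _ n] assoc_mult_mat[of _ n n _ n _ ?r])
        then show ?thesis using T D by simp
      qed
      then have "col (T * (A * D)) i = B *\<^sub>v col (T * D) i"
        using B T(1) D i by (metis carrier_matD(2) col_mult2 mult_carrier_mat)
      moreover have "col (T * (A * D)) i = unit_vec n i"
      proof -
        have "col (A * D) i = col S i" using A D S SD i rank_le_nc[OF A] by (intro eq_vecI) auto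
        then have "col (T * (A * D)) i = col (T * S) i"
          using col_mult2[OF T(1), of "A * D" ?r i] col_mult2[OF T(1) S, of i] A D i rank_le_nc[OF A] by simp
        then show ?thesis using T i rank_le_nc[OF A] by simp
      qed
      moreover have "y $ i = y \<bullet> unit_vec n i" using y i rank_le_nc[OF A] by simp
      moreover have cc: "col (T * D) i \<in> carrier_vec n"
        using T(1) by (intro carrier_vecI) simp
      ultimately have "y $ i = y \<bullet> (B *\<^sub>v col (T * D) i)" by simp
      also have "\<dots> = (B\<^sup>T *\<^sub>v y) \<bullet> col (T * D) i"
        using transpose_vec_mult_scalar[OF B, of "col (T * D) i" y] y cc by simp
      also have "\<dots> = 0" using BTy cc by simp
      finally show "y $ i = 0" .
    qed
  qed
  \<comment> \<open>Undoing the conjugation: the witness \<open>X\<close> is the transpose of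
    \<open>B\<close> carried back to the original basis.\<close>
  moreover have "A * (S * B\<^sup>T * T) + S * B\<^sup>T * T * A = S * (B * B\<^sup>T + B\<^sup>T * B) * T"
  proof -
    have "A * (S * B\<^sup>T * T) = S * B * (T * S) * B\<^sup>T * T"
      using S B T(1) by (subst SBT) (simp add: assoc_mult_mat[of _ n n _ n _ n])
    moreover have "S * B\<^sup>T * T * A = S * B\<^sup>T * (T * S) * B * T"
      using S B T(1) by (subst SBT) (simp add: assoc_mult_mat[of _ n n _ n _ n])
    ultimately show ?thesis using S B T
      by (simp add: assoc_mult_mat[of _ n n _ n _ n] mult_add_distrib_mat[of _ n n _ n] add_mult_distrib_mat[of _ n n _ _ n])
  qed
  ultimately have "det (A * (S * B\<^sup>T * T) + S * B\<^sup>T * T * A) \<noteq> 0"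
    using det_conj_inverse[OF S T(1) _ T(2), of "B * B\<^sup>T + B\<^sup>T * B"] B by simp
  then show ?thesis using that[of "S * B\<^sup>T * T"] S B T(1) by simp
qed

section \<open>Rank one perturbations\<close>

lemma det_add_mult:
  fixes M :: "'a::field mat"
  assumes M: "M \<in> carrier_mat n n" and N: "N \<in> carrier_mat n n" and MN: "M * N = 1\<^sub>m n"
    and P: "P \<in> carrier_mat n k" and Q: "Q \<in> carrier_mat k n"
  shows "det (M + P * Q) = det M * det (1\<^sub>m k + Q * (N * P))"
proof -
  let ?L = "four_block_mat (1\<^sub>m k) (- Q) P M"
  have MNP: "M * (N * P) = P"
    using assoc_mult_mat[OF M N P] MN P by simp
  \<comment> \<open>Sylvester's determinant identity: eliminate either off-diagonal block of \<open>?L\<close>.\<close>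
  have "?L = four_block_mat (1\<^sub>m k) (0\<^sub>m k n) P (1\<^sub>m n) * four_block_mat (1\<^sub>m k) (- Q) (0\<^sub>m n k) (M + P * Q)"
    using M P Q by (subst mult_four_block_mat[of _ k k _ n _ n _ _ k _ n])
      (auto intro!: cong_four_block_mat)
  then have "det ?L = det (M + P * Q)"
    using M P Q by (simp add: det_mult[of _ "k + n"] det_four_block_mat_upper_right_zero[of _ k _ n]
      det_four_block_mat_lower_left_zero[of _ k _ n])
  moreover have "?L = four_block_mat (1\<^sub>m k + Q * (N * P)) (- Q) (0\<^sub>m n k) M *
      four_block_mat (1\<^sub>m k) (0\<^sub>m k n) (N * P) (1\<^sub>m n)"
    using M N P Q MNP by (subst mult_four_block_mat[of _ k k _ n _ n _ _ k _ n])
      (auto intro!: cong_four_block_mat simp del: assoc_mult_mat)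
  then have "det ?L = det (1\<^sub>m k + Q * (N * P)) * det M"
    using M N P Q by (simp add: det_mult[of _ "k + n"] det_four_block_mat_upper_right_zero[of _ k _ n]
      det_four_block_mat_lower_left_zero[of _ k _ n])
  ultimately show ?thesis by (simp add: mult.commute)
qed

lemma det_2_by_2:
  fixes A :: "'a::field mat"
  assumes A: "A \<in> carrier_mat 2 2"
  shows "det A = A $$ (0,0) * A $$ (1,1) - A $$ (0,1) * A $$ (1,0)"
proof -
  let ?e = "\<lambda>x :: 'a. mat 1 1 (\<lambda>_. x)"
  let ?F = "four_block_mat (?e (A $$ (0,0))) (?e (A $$ (0,1))) (?e (A $$ (1,0))) (?e (A $$ (1,1)))"
  have "A = ?F"
    using A by (intro eq_matI) (auto simp: numeral_2_eq_2 less_Suc_eq)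
  then have "det A = det ?F" by (rule arg_cong)
  also have "det ?F = det (?e (A $$ (0,0)) * ?e (A $$ (1,1)) - ?e (A $$ (0,1)) * ?e (A $$ (1,0)))"
    by (rule det_four_block_mat) (auto intro!: eq_matI simp: scalar_prod_def)
  also have "\<dots> = A $$ (0,0) * A $$ (1,1) - A $$ (0,1) * A $$ (1,0)"
    by (subst det_single) (auto simp: scalar_prod_def)
  finally show ?thesis .
qed

text \<open>For \<open>Y = t u v\<^sup>T\<close> the perturbation \<open>A * Y + Y * A\<close> is a
  sum of two rank one matrices, with columns \<open>t A u\<close>, \<open>t u\<close> and rows
  \<open>v\<^sup>T\<close>, \<open>v\<^sup>T A\<close>. By \<open>det_add_mult\<close> only a 2 by 2
  determinant remains.\<close>

lemma det_anticommutator_rank_one: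
  fixes A :: "'a::field mat" and t :: 'a
  assumes A: "A \<in> carrier_mat n n" and X: "X \<in> carrier_mat n n" and N: "N \<in> carrier_mat n n"
    and MN: "(A * X + X * A) * N = 1\<^sub>m n"
    and u: "u \<in> carrier_vec n" and v: "v \<in> carrier_vec n"
  defines "Y \<equiv> mat n n (\<lambda>(i,j). t * u $ i * v $ j)"
  shows "det (A * (X + Y) + (X + Y) * A) = det (A * X + X * A) *
    ((1 + t * (v \<bullet> (N *\<^sub>v (A *\<^sub>v u)))) * (1 + t * (v \<bullet> (A *\<^sub>v (N *\<^sub>v u)))) -
     t\<^sup>2 * (v \<bullet> (N *\<^sub>v u)) * (v \<bullet> (A *\<^sub>v (N *\<^sub>v (A *\<^sub>v u)))))"
proof -
  let ?M = "A * X + X * A"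
  define P where "P = mat_of_cols n [t \<cdot>\<^sub>v (A *\<^sub>v u), t \<cdot>\<^sub>v u]"
  define Q where "Q = mat_of_rows n [v, A\<^sup>T *\<^sub>v v]"
  have P: "P \<in> carrier_mat n 2" and Q: "Q \<in> carrier_mat 2 n"
    unfolding P_def Q_def by (auto simp: numeral_2_eq_2)
  have Y: "Y \<in> carrier_mat n n" by (simp add: Y_def)
  have "A * Y + Y * A = P * Q"
  proof (rule eq_matI)
    fix i j assume "i < dim_row (P * Q)" "j < dim_col (P * Q)"
    then have ij: "i < n" "j < n" using P Q by auto
    have "(A * Y) $$ (i,j) = t * (A *\<^sub>v u) $ i * v $ j"
      using ij A u by (simp add: Y_def scalar_prod_def sum_distrib_left sum_distrib_right mult_ac)
    moreover have "(Y * A) $$ (i,j) = t * u $ i * (A\<^sup>T *\<^sub>v v) $ j"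
      using ij A v by (simp add: Y_def scalar_prod_def sum_distrib_left sum_distrib_right mult_ac)
    moreover have "(P * Q) $$ (i,j) = t * (A *\<^sub>v u) $ i * v $ j + t * u $ i * (A\<^sup>T *\<^sub>v v) $ j"
      using ij A u v by (simp add: P_def Q_def scalar_prod_def mat_of_cols_def mat_of_rows_def numeral_2_eq_2 del: index_mult_mat_vec)
    ultimately show "(A * Y + Y * A) $$ (i,j) = (P * Q) $$ (i,j)" using ij A Y by simp
  qed (use A Y P Q in auto)
  moreover have "A * (X + Y) + (X + Y) * A = ?M + (A * Y + Y * A)"
    unfolding mult_add_distrib_mat[OF A X Y] add_mult_distrib_mat[OF X Y A]
    using A X Y by (intro eq_matI) auto
  ultimately have "A * (X + Y) + (X + Y) * A = ?M + P * Q" by simp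
  then have "det (A * (X + Y) + (X + Y) * A) = det ?M * det (1\<^sub>m 2 + Q * (N * P))"
    using det_add_mult[OF _ N MN P Q] A X by simp
  also have "det (1\<^sub>m 2 + Q * (N * P)) =
    (1 + t * (v \<bullet> (N *\<^sub>v (A *\<^sub>v u)))) * (1 + t * ((A\<^sup>T *\<^sub>v v) \<bullet> (N *\<^sub>v u))) -
     (t * (v \<bullet> (N *\<^sub>v u))) * (t * ((A\<^sup>T *\<^sub>v v) \<bullet> (N *\<^sub>v (A *\<^sub>v u))))"
  proof -
    let ?D = "1\<^sub>m 2 + Q * (N * P)"
    have ent: "?D $$ (a,b) = (if a = b then 1 else 0) + row Q a \<bullet> (N *\<^sub>v col P b)" if "a < 2" "b < 2" for a b
      using that Q P N by (simp add: mult_mat_vec_def)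
    have rc: "row Q 0 = v" "row Q 1 = A\<^sup>T *\<^sub>v v" "col P 0 = t \<cdot>\<^sub>v (A *\<^sub>v u)" "col P 1 = t \<cdot>\<^sub>v u"
      using A u v by (auto simp: P_def Q_def)
    have sm: "x \<bullet> (N *\<^sub>v (t \<cdot>\<^sub>v y)) = t * (x \<bullet> (N *\<^sub>v y))"
      if "x \<in> carrier_vec n" "y \<in> carrier_vec n" for x y
      using that N by (simp add: mult_mat_vec[of _ n n])
    have cv: "A *\<^sub>v u \<in> carrier_vec n" "A\<^sup>T *\<^sub>v v \<in> carrier_vec n" using A u v by auto
    have "det ?D = ?D $$ (0,0) * ?D $$ (1,1) - ?D $$ (0,1) * ?D $$ (1,0)"
      using P Q N by (intro det_2_by_2) simp
    also have "\<dots> = (1 + v \<bullet> (N *\<^sub>v (t \<cdot>\<^sub>v (A *\<^sub>v u)))) * (1 + (A\<^sup>T *\<^sub>v v) \<bullet> (N *\<^sub>v (t \<cdot>\<^sub>v u))) -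
        v \<bullet> (N *\<^sub>v (t \<cdot>\<^sub>v u)) * ((A\<^sup>T *\<^sub>v v) \<bullet> (N *\<^sub>v (t \<cdot>\<^sub>v (A *\<^sub>v u))))"
      using ent[of 0 0] ent[of 1 1] ent[of 0 1] ent[of 1 0] unfolding rc by simp
    finally show ?thesis by (simp only: sm[OF v cv(1)] sm[OF v u] sm[OF cv(2) cv(1)] sm[OF cv(2) u])
  qed
  also have "(A\<^sup>T *\<^sub>v v) \<bullet> (N *\<^sub>v u) = v \<bullet> (A *\<^sub>v (N *\<^sub>v u))"
    using transpose_vec_mult_scalar[OF A, of "N *\<^sub>v u" v] N u v by simp
  also have "(A\<^sup>T *\<^sub>v v) \<bullet> (N *\<^sub>v (A *\<^sub>v u)) = v \<bullet> (A *\<^sub>v (N *\<^sub>v (A *\<^sub>v u)))"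
    using transpose_vec_mult_scalar[OF A, of "N *\<^sub>v (A *\<^sub>v u)" v] A N u v by simp
  finally show ?thesis by (simp add: power2_eq_square mult_ac)
qed

section \<open>Tools for exploiting a nonpositive discriminant\<close>

lemma quadratic_nonneg_discriminant:
  fixes p s :: real
  assumes "\<And>t. 0 \<le> 1 + p * t + s * t\<^sup>2"
  shows "p\<^sup>2 \<le> 4 * s"
proof -
  \<comment> \<open>The sign of \<open>s\<close> is not known in advance. For \<open>s > 0\<close>
    the vertex is tested; the next two cases are refuted at a point where the polynomial is at most
    -1; in the last one both sides are zero.\<close>
  consider "s > 0" | "s \<le> 0" "p \<noteq> 0" | "s < 0" "p = 0" | "s = 0" "p = 0" by linarith
  then show ?thesis
  proof cases
    case 1
    with assms[of "- p / (2 * s)"] show ?thesis by (simp add: field_simps power2_eq_square)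
  next
    case 2
    have "s * (- 2 / p)\<^sup>2 \<le> 0" using 2 by (simp add: mult_nonpos_nonneg)
    with assms[of "- 2 / p"] 2 show ?thesis by simp
  next
    case 3
    then have "s * (sqrt (- 2 / s))\<^sup>2 = - 2" by (simp add: divide_nonpos_neg)
    with assms[of "sqrt (- 2 / s)"] 3 show ?thesis by simp
  qed simp
qed

text \<open>Distinct unit vectors are orthogonal, which kills the off-diagonal entries; the
  orthogonal pair \<open>e_i - e_0\<close>, \<open>e_i + e_0\<close> then equates the diagonal
  ones.\<close>

lemma scalar_matI:
  fixes K :: "real mat"
  assumes K: "K \<in> carrier_mat n n"
    and orth: "\<And>v w. v \<in> carrier_vec n \<Longrightarrow> w \<in> carrier_vec n \<Longrightarrow> v \<bullet> w = 0 \<Longrightarrow> v \<bullet> (K *\<^sub>v w) = 0"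
  shows "K = K $$ (0,0) \<cdot>\<^sub>m 1\<^sub>m n"
proof -
  let ?e = "unit_vec n :: nat \<Rightarrow> real vec"
  have ent: "?e i \<bullet> (K *\<^sub>v ?e j) = K $$ (i,j)" if "i < n" "j < n" for i j
    using that K by simp
  have off: "K $$ (i,j) = 0" if "i < n" "j < n" "i \<noteq> j" for i j
    using orth[of "?e i" "?e j"] ent[of i j] that by simp
  have diag: "K $$ (i,i) = K $$ (0,0)" if i: "i < n" for i
  proof (cases "i = 0")
    case False
    have c: "?e i \<in> carrier_vec n" "?e 0 \<in> carrier_vec n" "K *\<^sub>v ?e i \<in> carrier_vec n" "K *\<^sub>v ?e 0 \<in> carrier_vec n"
      using K by auto
    have n: "0 < n" using i by simp
    have "(?e i - ?e 0) \<bullet> (?e i + ?e 0) = 0"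
      using False i n by (simp add: minus_scalar_prod_distrib[of _ n] scalar_prod_add_distrib[of _ n])
    then have "(?e i - ?e 0) \<bullet> (K *\<^sub>v (?e i + ?e 0)) = 0" using orth by simp
    also have "K *\<^sub>v (?e i + ?e 0) = K *\<^sub>v ?e i + K *\<^sub>v ?e 0"
      using K by (simp add: mult_add_distrib_mat_vec[of _ n n])
    also have "(?e i - ?e 0) \<bullet> (K *\<^sub>v ?e i + K *\<^sub>v ?e 0) =
        ?e i \<bullet> (K *\<^sub>v ?e i + K *\<^sub>v ?e 0) - ?e 0 \<bullet> (K *\<^sub>v ?e i + K *\<^sub>v ?e 0)"
      by (rule minus_scalar_prod_distrib[OF c(1,2)]) (use c in simp)
    also have "\<dots> = K $$ (i,i) + K $$ (i,0) - (K $$ (0,i) + K $$ (0,0))"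
      by (simp only: scalar_prod_add_distrib[OF c(1,3,4)] scalar_prod_add_distrib[OF c(2,3,4)]
        ent[OF i i] ent[OF i n] ent[OF n i] ent[OF n n])
    finally show ?thesis using off[of i 0] off[of 0 i] False i n by simp
  qed simp
  show ?thesis
  proof (rule eq_matI)
    fix i j assume "i < dim_row (K $$ (0,0) \<cdot>\<^sub>m 1\<^sub>m n)" "j < dim_col (K $$ (0,0) \<cdot>\<^sub>m 1\<^sub>m n)"
    then show "K $$ (i,j) = (K $$ (0,0) \<cdot>\<^sub>m 1\<^sub>m n) $$ (i,j)"
      using off[of i j] diag[of i] by (cases "i = j") auto
  qed (use K in auto)
qed

text \<open>Cyclicity of the trace, written out as a sum over the diagonal.\<close>

lemma sum_diag_mult_commute:
  fixes P :: "'a::comm_semiring_0 mat"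
  assumes "P \<in> carrier_mat n n" "Q \<in> carrier_mat n n"
  shows "(\<Sum>i<n. (P * Q) $$ (i,i)) = (\<Sum>i<n. (Q * P) $$ (i,i))"
proof -
  have "(\<Sum>i<n. (P * Q) $$ (i,i)) = (\<Sum>i<n. \<Sum>j<n. P $$ (i,j) * Q $$ (j,i))"
    using assms by (intro sum.cong) (auto simp: scalar_prod_def atLeast0LessThan)
  also have "\<dots> = (\<Sum>j<n. \<Sum>i<n. Q $$ (j,i) * P $$ (i,j))"
    by (subst sum.swap) (simp add: mult.commute)
  also have "\<dots> = (\<Sum>j<n. (Q * P) $$ (j,j))"
    using assms by (intro sum.cong) (auto simp: scalar_prod_def atLeast0LessThan)
  finally show ?thesis .
qed

text \<open>For small \<open>e\<close> of the sign of \<open>x\<close> the linear term dominates;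
  \<open>e = x / k\<close> with \<open>k\<close> larger than the absolute value of \<open>y\<close>
  is small enough.\<close>

lemma linear_coeff_eq_0:
  fixes x y :: real
  assumes "\<And>e. e * x + e\<^sup>2 * y \<le> 0"
  shows "x = 0"
proof (rule ccontr)
  assume x: "x \<noteq> 0"
  define k where "k = \<bar>y\<bar> + 1"
  have k: "k > 0" "k + y > 0" unfolding k_def by linarith+
  have "(x / k) * x + (x / k)\<^sup>2 * y = x\<^sup>2 * (k + y) / k\<^sup>2"
    using k by (simp add: field_simps power2_eq_square)
  moreover have "x\<^sup>2 * (k + y) / k\<^sup>2 > 0" using k x by simp
  ultimately show False using assms[of "x / k"] by simp
qed

lemma square_scalar_of_det_anticommutator_nonneg:
  fixes A :: "real mat"
  assumes A: "A \<in> carrier_mat n n" and n: "0 < n"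
    and nonneg: "\<And>X. X \<in> carrier_mat n n \<Longrightarrow> 0 \<le> det (A * X + X * A)"
    and X: "X \<in> carrier_mat n n" and det: "det (A * X + X * A) \<noteq> 0"
  obtains \<alpha> where "\<alpha> \<le> 0" "A * A = \<alpha> \<cdot>\<^sub>m 1\<^sub>m n"
proof -
  define M where "M = A * X + X * A"
  have M: "M \<in> carrier_mat n n" using A X by (simp add: M_def)
  obtain N where N: "N \<in> carrier_mat n n" "M * N = 1\<^sub>m n" "N * M = 1\<^sub>m n"
    using nonsingular_inverse[OF M] det M_def by blast
  have detM: "det M > 0" using nonneg[OF X] det by (simp add: M_def)
  \<comment> \<open>\<open>G\<close> is \<open>A\<close> conjugated by \<open>M\<close>.
    Substituting \<open>u = M w\<close> in the discriminant inequality turns \<open>N u\<close> into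
    \<open>w\<close> and \<open>N A u\<close> into \<open>G w\<close>.\<close>
  define G where "G = N * (A * M)"
  have G: "G \<in> carrier_mat n n" using N A M by (simp add: G_def)
  have ineq: "(v \<bullet> (G *\<^sub>v w) - v \<bullet> (A *\<^sub>v w))\<^sup>2 + 4 * ((v \<bullet> w) * (v \<bullet> (A *\<^sub>v (G *\<^sub>v w)))) \<le> 0"
    if v: "v \<in> carrier_vec n" and w: "w \<in> carrier_vec n" for v w
  proof -
    let ?u = "M *\<^sub>v w"
    let ?a = "v \<bullet> (G *\<^sub>v w)" and ?b = "v \<bullet> (A *\<^sub>v w)" and ?c = "v \<bullet> w" and ?d = "v \<bullet> (A *\<^sub>v (G *\<^sub>v w))"
    have u: "?u \<in> carrier_vec n" using M w by simp
    have Nu: "N *\<^sub>v ?u = w"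
      using N M w by (simp flip: assoc_mult_mat_vec[of N n n M n w])
    have NAu: "N *\<^sub>v (A *\<^sub>v ?u) = G *\<^sub>v w"
      using N M A w by (simp add: G_def assoc_mult_mat_vec[of _ n n _ n])
    have "0 \<le> 1 + (?a + ?b) * t + (?a * ?b - ?c * ?d) * t\<^sup>2" for t
    proof -
      let ?Y = "mat n n (\<lambda>(i,j). t * ?u $ i * v $ j)"
      have "0 \<le> det (A * (X + ?Y) + (X + ?Y) * A)" using nonneg X by simp
      also have "\<dots> = det M * ((1 + t * ?a) * (1 + t * ?b) - t\<^sup>2 * ?c * ?d)"
        using det_anticommutator_rank_one[OF A X N(1) _ u v, of t] N(2) Nu NAu
        by (simp add: M_def del: index_mult_mat_vec)
      finally have "0 \<le> (1 + t * ?a) * (1 + t * ?b) - t\<^sup>2 * ?c * ?d"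
        using detM by (simp add: zero_le_mult_iff)
      then show ?thesis by (simp add: algebra_simps power2_eq_square)
    qed
    then have "(?a + ?b)\<^sup>2 \<le> 4 * (?a * ?b - ?c * ?d)" by (rule quadratic_nonneg_discriminant)
    then show ?thesis by (simp add: algebra_simps power2_eq_square)
  qed
  define \<mu> where "\<mu> = (G - A) $$ (0,0)"
  \<comment> \<open>For orthogonal \<open>v\<close>, \<open>w\<close> the product term of
    \<open>ineq\<close> vanishes and a square remains that is at most zero.\<close>
  have "G - A = \<mu> \<cdot>\<^sub>m 1\<^sub>m n" unfolding \<mu>_def
  proof (rule scalar_matI)
    fix v w :: "real vec" assume v: "v \<in> carrier_vec n" and w: "w \<in> carrier_vec n" and "v \<bullet> w = 0"
    then have "(v \<bullet> (G *\<^sub>v w) - v \<bullet> (A *\<^sub>v w))\<^sup>2 \<le> 0" using ineq[OF v w] by simp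
    then have "v \<bullet> (G *\<^sub>v w) - v \<bullet> (A *\<^sub>v w) = 0" by simp
    then show "v \<bullet> ((G - A) *\<^sub>v w) = 0"
      using v w G A by (simp add: minus_mult_distrib_mat_vec[of _ n n] scalar_prod_minus_distrib[of _ n])
  qed (rule minus_carrier_mat[OF A])
  then have ent: "G $$ (i,j) - A $$ (i,j) = (\<mu> \<cdot>\<^sub>m 1\<^sub>m n) $$ (i,j)" if "i < n" "j < n" for i j
    using that G A by (metis carrier_matD index_minus_mat(1))
  \<comment> \<open>Conjugate matrices have equal trace, while \<open>G - A\<close> has trace
    \<open>n * \<mu>\<close>; hence \<open>\<mu> = 0\<close>.\<close>
  have "A * M * N = A" using A M N by simp
  then have "(\<Sum>i<n. G $$ (i,i)) = (\<Sum>i<n. A $$ (i,i))"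
    using sum_diag_mult_commute[of N n "A * M"] N A M by (simp add: G_def)
  then have "(\<Sum>i<n. G $$ (i,i) - A $$ (i,i)) = 0" by (simp add: sum_subtractf)
  moreover have "(\<Sum>i<n. G $$ (i,i) - A $$ (i,i)) = (\<Sum>i<n. \<mu>)"
    using ent by (intro sum.cong) auto
  ultimately have "\<mu> = 0" using n by simp
  then have GA: "G = A" using ent G A by (intro eq_matI) auto
  have ineq2: "(v \<bullet> w) * (v \<bullet> (A * A *\<^sub>v w)) \<le> 0"
    if v: "v \<in> carrier_vec n" and w: "w \<in> carrier_vec n" for v w
    using ineq[OF v w] A w by (simp add: GA)
  let ?\<alpha> = "(A * A) $$ (0,0)"
  have AA: "A * A \<in> carrier_mat n n" using A by simp
  have "A * A = ?\<alpha> \<cdot>\<^sub>m 1\<^sub>m n"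
  proof (rule scalar_matI[OF AA])
    fix v w :: "real vec" assume v: "v \<in> carrier_vec n" and w: "w \<in> carrier_vec n" and vw: "v \<bullet> w = 0"
    let ?x = "v \<bullet> (A * A *\<^sub>v w)" and ?y = "v \<bullet> (A * A *\<^sub>v v)"
    show "?x = 0"
    proof (cases "v \<bullet> v = 0")
      case True
      then have "v = 0\<^sub>v n" using scalar_prod_self_eq_0 v by blast
      then show ?thesis using AA w by (simp del: assoc_mult_mat_vec)
    next
      case False
      then have pos: "v \<bullet> v > 0" using scalar_prod_self_nonneg[of v] by linarith
      show ?thesis
      \<comment> \<open>Moving \<open>w\<close> to \<open>w + e v\<close> breaks the orthogonality
        to first order in \<open>e\<close>; since \<open>e\<close> may have either sign, the
        inequality forces \<open>?x\<close> to vanish.\<close>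
      proof (rule linear_coeff_eq_0)
        fix e :: real
        have "v \<bullet> (w + e \<cdot>\<^sub>v v) = e * (v \<bullet> v)"
          using v w vw by (simp add: scalar_prod_add_distrib[of _ n])
        moreover have "v \<bullet> (A * A *\<^sub>v (w + e \<cdot>\<^sub>v v)) = ?x + e * ?y"
          using v w AA by (simp add: mult_add_distrib_mat_vec[of _ n n] mult_mat_vec[of _ n n]
            scalar_prod_add_distrib[of _ n] del: assoc_mult_mat_vec)
        ultimately have "(e * (v \<bullet> v)) * (?x + e * ?y) \<le> 0"
          using ineq2[OF v, of "w + e \<cdot>\<^sub>v v"] v w by simp
        then have "(v \<bullet> v) * (e * ?x + e\<^sup>2 * ?y) \<le> 0"
          by (simp add: algebra_simps power2_eq_square del: assoc_mult_mat_vec)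
        then show "e * ?x + e\<^sup>2 * ?y \<le> 0" using pos by (simp add: mult_le_0_iff del: assoc_mult_mat_vec)
      qed
    qed
  qed
  \<comment> \<open>The case where \<open>v\<close> and \<open>w\<close> both equal the first unit
    vector.\<close>
  moreover have "?\<alpha> \<le> 0"
  proof -
    have "(T *\<^sub>v unit_vec n 0) $ 0 = T $$ (0,0)" if "T \<in> carrier_mat n n" for T :: "real mat"
      using that n by simp
    from this[OF AA] show ?thesis
      using ineq2[of "unit_vec n 0" "unit_vec n 0"] n AA by (simp del: assoc_mult_mat_vec index_mult_mat(1))
  qed
  ultimately show ?thesis using that by blast
qed

section \<open>Squares that are nonpositive scalars\<close>

lemma smult_smult_mat: "a \<cdot>\<^sub>m (b \<cdot>\<^sub>m A) = (a * b :: 'a::semigroup_mult) \<cdot>\<^sub>m A"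
  by (intro eq_matI) (auto simp: mult.assoc)

text \<open>\<open>E\<close> and \<open>F\<close> are complementary projections commuting with
  \<open>M\<close>. The first factor acts as \<open>M\<close> on the image of \<open>E\<close> and
  as the identity on the image of \<open>F\<close>; the second one exchanges these roles.\<close>

lemma orthogonal_idempotents_split:
  fixes M :: "'a::comm_ring_1 mat"
  assumes M: "M \<in> carrier_mat n n" and E: "E \<in> carrier_mat n n" and F: "F \<in> carrier_mat n n"
    and EF: "E + F = 1\<^sub>m n" "E * F = 0\<^sub>m n n" "F * E = 0\<^sub>m n n" and comm: "M * E = E * M" "M * F = F * M"
  shows "(M * E + F) * (E + M * F) = M"
proof -
  have ME: "M * E \<in> carrier_mat n n" and MF: "M * F \<in> carrier_mat n n"
    and EMF: "E + M * F \<in> carrier_mat n n"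
    using M E F by auto
  have "E * (E + F) = E * E" using E F EF(2) by (simp add: mult_add_distrib_mat[of _ n n _ n])
  then have EE: "E * E = E" using EF(1) E by simp
  have "F * (E + F) = F * F" using E F EF(3) by (simp add: mult_add_distrib_mat[of _ n n _ n])
  then have FF: "F * F = F" using EF(1) F by simp
  have "E * (M * F) = M * E * F" using assoc_mult_mat[OF E M F] comm(1) by simp
  also have "\<dots> = 0\<^sub>m n n" using assoc_mult_mat[OF M E F] EF(2) M by simp
  finally have 1: "M * E * (M * F) = 0\<^sub>m n n"
    using assoc_mult_mat[OF M E, of "M * F" n] M F by simp
  have "F * (M * F) = M * (F * F)"
    using assoc_mult_mat[OF F M F] assoc_mult_mat[OF M F F] comm(2) by simp
  then have 2: "F * (M * F) = M * F" using FF by simp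
  have "(M * E + F) * (E + M * F) = M * E * E + M * E * (M * F) + (F * E + F * (M * F))"
    unfolding add_mult_distrib_mat[OF ME F EMF] mult_add_distrib_mat[OF ME E MF]
      mult_add_distrib_mat[OF F E MF] ..
  also have "M * E * E = M * E" using M E EE by simp
  also have "M * E + M * E * (M * F) + (F * E + F * (M * F)) = M * (E + F)"
    unfolding 1 2 EF(3) using M E F by (simp add: mult_add_distrib_mat[of _ n n _ n])
  also have "\<dots> = M" using EF(1) M by simp
  finally show ?thesis .
qed

text \<open>\<open>J\<close> turns the real space into a complex one on which \<open>M\<close> is
  complex linear. The real determinant is then the squared modulus of the complex one, realised here
  as \<open>det (M' * E + F)\<close>.\<close>

lemma det_nonneg_of_commute_complex_structure:
  fixes J :: "real mat"
  assumes J: "J \<in> carrier_mat n n" and M: "M \<in> carrier_mat n n"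
    and JJ: "J * J = - 1\<^sub>m n" and MJ: "M * J = J * M"
  shows "0 \<le> det M"
proof -
  interpret cnj: comm_ring_hom cnj by unfold_locales auto
  define J' where "J' = map_mat complex_of_real J"
  define M' where "M' = map_mat complex_of_real M"
  define K where "K = \<i> \<cdot>\<^sub>m J'"
  define E where "E = (1 / 2) \<cdot>\<^sub>m (1\<^sub>m n - K)"
  define F where "F = (1 / 2) \<cdot>\<^sub>m (1\<^sub>m n + K)"
  have J': "J' \<in> carrier_mat n n" and M': "M' \<in> carrier_mat n n" using J M by (auto simp: J'_def M'_def)
  then have K: "K \<in> carrier_mat n n" by (simp add: K_def)
  then have E: "E \<in> carrier_mat n n" and F: "F \<in> carrier_mat n n" by (auto simp: E_def F_def minus_carrier_mat)
  have "J' * J' = map_mat complex_of_real (J * J)"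
    unfolding J'_def by (rule of_real_hom.mat_hom_mult[OF J J, symmetric])
  also have "\<dots> = - 1\<^sub>m n" unfolding JJ by (intro eq_matI) auto
  finally have J'J': "J' * J' = - 1\<^sub>m n" .
  have MJ': "M' * J' = J' * M'"
    unfolding J'_def M'_def of_real_hom.mat_hom_mult[OF J M, symmetric] of_real_hom.mat_hom_mult[OF M J, symmetric] MJ ..
  have "K * K = (\<i> * \<i>) \<cdot>\<^sub>m (J' * J')"
    using J' by (simp add: K_def mult_smult_distrib[of _ n n _ n] mult_smult_assoc_mat[of _ n n _ n] smult_smult_mat)
  also have "\<dots> = 1\<^sub>m n" unfolding J'J' by (intro eq_matI) auto
  finally have KK: "K * K = 1\<^sub>m n" .
  have MK: "M' * K = K * M'"
    using J' M' MJ' by (simp add: K_def mult_smult_distrib[of _ n n _ n] mult_smult_assoc_mat[of _ n n _ n])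
  have "E + F = 1\<^sub>m n" using K by (intro eq_matI) (auto simp: E_def F_def field_simps)
  moreover have "E * F = 0\<^sub>m n n"
  proof -
    have "(1\<^sub>m n - K) * (1\<^sub>m n + K) = 0\<^sub>m n n"
      using K KK by (simp add: mult_add_distrib_mat[of _ n n _ n] minus_mult_distrib_mat[of _ n n _ _ n] minus_carrier_mat)
        (intro eq_matI; simp)
    then show ?thesis using K
      by (simp add: E_def F_def mult_smult_distrib[of _ n n _ n] mult_smult_assoc_mat[of _ n n _ n] minus_carrier_mat)
  qed
  moreover have "F * E = 0\<^sub>m n n"
  proof -
    have "(1\<^sub>m n + K) * (1\<^sub>m n - K) = 0\<^sub>m n n"
      using K KK by (simp add: mult_minus_distrib_mat[of _ n n _ n] add_mult_distrib_mat[of _ n n _ _ n] minus_carrier_mat)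
        (intro eq_matI; simp)
    then show ?thesis using K
      by (simp add: E_def F_def mult_smult_distrib[of _ n n _ n] mult_smult_assoc_mat[of _ n n _ n] minus_carrier_mat)
  qed
  moreover have "M' * E = E * M'"
    using M' K MK by (simp add: E_def mult_smult_distrib[of _ n n _ n] mult_smult_assoc_mat[of _ n n _ n]
      mult_minus_distrib_mat[of _ n n _ n] minus_mult_distrib_mat[of _ n n _ _ n] minus_carrier_mat)
  moreover have "M' * F = F * M'"
    using M' K MK by (simp add: F_def mult_smult_distrib[of _ n n _ n] mult_smult_assoc_mat[of _ n n _ n]
      mult_add_distrib_mat[of _ n n _ n] add_mult_distrib_mat[of _ n n _ _ n])
  ultimately have "M' = (M' * E + F) * (E + M' * F)"
    using orthogonal_idempotents_split[OF M' E F] by simp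
  then have "det M' = det (M' * E + F) * det (E + M' * F)"
    using M' E F by (metis add_carrier_mat det_mult mult_carrier_mat)
  \<comment> \<open>\<open>M'\<close> and \<open>J'\<close> have real entries, so conjugation fixes
    \<open>M'\<close>, negates \<open>K\<close> and thereby exchanges \<open>E\<close> and
    \<open>F\<close>.\<close>
  also have "E + M' * F = map_mat cnj (M' * E + F)"
  proof -
    have cM: "map_mat cnj M' = M'" by (intro eq_matI) (auto simp: M'_def)
    have cK: "map_mat cnj K = - K" using J by (intro eq_matI) (auto simp: K_def J'_def)
    have cE: "map_mat cnj E = F" and cF: "map_mat cnj F = E"
    proof -
      have "cnj (K $$ (i,j)) = - K $$ (i,j)" if "i < n" "j < n" for i j
        using that cK K by (metis carrier_matD index_map_mat(1) index_uminus_mat(1))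
      then show "map_mat cnj E = F" "map_mat cnj F = E"
        using K by (auto simp: E_def F_def intro!: eq_matI)
    qed
    have "map_mat cnj (M' * E + F) = map_mat cnj M' * map_mat cnj E + map_mat cnj F"
      using cnj.mat_hom_mult[OF M' E] M' E F by (intro eq_matI) (auto simp flip: cnj.mat_hom_mult)
    then show ?thesis using cM cE cF M' E F by (simp add: comm_add_mat[of _ n n])
  qed
  also have "det (map_mat cnj (M' * E + F)) = cnj (det (M' * E + F))" by simp
  finally have "complex_of_real (det M) = (cmod (det (M' * E + F)))\<^sup>2"
    by (simp add: M'_def complex_norm_square del: of_real_power)
  then have "det M = (cmod (det (M' * E + F)))\<^sup>2" by (simp only: of_real_eq_iff)
  then show ?thesis by simp
qed

text \<open>The square of \<open>A\<close> is central, so both products equal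
  \<open>A * X * A\<close> plus \<open>\<alpha>\<close> times \<open>X\<close>.\<close>

lemma anticommutator_commute:
  fixes A :: "'a::comm_ring_1 mat"
  assumes A: "A \<in> carrier_mat n n" and X: "X \<in> carrier_mat n n" and AA: "A * A = \<alpha> \<cdot>\<^sub>m 1\<^sub>m n"
  shows "(A * X + X * A) * A = A * (A * X + X * A)"
proof -
  have "(A * X + X * A) * A = A * X * A + X * (A * A)"
    using A X by (simp add: add_mult_distrib_mat[of _ n n _ _ n])
  also have "X * (A * A) = (A * A) * X"
    unfolding AA using X by (simp add: mult_smult_distrib[of _ n n _ n] mult_smult_assoc_mat[of _ n n _ n])
  also have "A * X * A + A * A * X = A * (A * X + X * A)"
    using A X by (simp add: mult_add_distrib_mat[of _ n n _ n] comm_add_mat[of _ n n])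
  finally show ?thesis .
qed

lemma det_anticommutator_nonneg_of_square_neg:
  fixes A :: "real mat"
  assumes A: "A \<in> carrier_mat n n" and X: "X \<in> carrier_mat n n"
    and AA: "A * A = \<alpha> \<cdot>\<^sub>m 1\<^sub>m n" and \<alpha>: "\<alpha> < 0"
  shows "0 \<le> det (A * X + X * A)"
proof -
  define c where "c = 1 / sqrt (- \<alpha>)"
  have c: "c * c * \<alpha> = - 1" using \<alpha> by (simp add: c_def field_simps)
  show ?thesis
  proof (rule det_nonneg_of_commute_complex_structure)
    show "c \<cdot>\<^sub>m A \<in> carrier_mat n n" "A * X + X * A \<in> carrier_mat n n" using A X by auto
    have "(c \<cdot>\<^sub>m A) * (c \<cdot>\<^sub>m A) = (c * c) \<cdot>\<^sub>m (A * A)"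
      using A by (simp add: mult_smult_distrib[of _ n n _ n] mult_smult_assoc_mat[of _ n n _ n] smult_smult_mat)
    then show "(c \<cdot>\<^sub>m A) * (c \<cdot>\<^sub>m A) = - 1\<^sub>m n"
      unfolding AA using c by (intro eq_matI) auto
    have "(A * X + X * A) * (c \<cdot>\<^sub>m A) = c \<cdot>\<^sub>m ((A * X + X * A) * A)"
      using A X by (intro mult_smult_distrib[of _ n n _ n]) auto
    also have "\<dots> = c \<cdot>\<^sub>m (A * (A * X + X * A))" using anticommutator_commute[OF A X AA] by simp
    also have "\<dots> = (c \<cdot>\<^sub>m A) * (A * X + X * A)"
      using A X by (intro mult_smult_assoc_mat[of _ n n _ n, symmetric]) auto
    finally show "(A * X + X * A) * (c \<cdot>\<^sub>m A) = (c \<cdot>\<^sub>m A) * (A * X + X * A)" .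
  qed
qed

section \<open>Entrywise limits of determinants\<close>

lemma tendsto_det:
  fixes M :: "'b \<Rightarrow> real mat"
  assumes M: "\<And>x. M x \<in> carrier_mat n n" and L: "L \<in> carrier_mat n n"
    and lim: "\<And>i j. i < n \<Longrightarrow> j < n \<Longrightarrow> ((\<lambda>x. M x $$ (i,j)) \<longlongrightarrow> L $$ (i,j)) F"
  shows "((\<lambda>x. det (M x)) \<longlongrightarrow> det L) F"
  unfolding det_def'[OF M] det_def'[OF L]
  \<comment> \<open>In the Leibniz expansion, permutations keep the indices below \<open>n\<close>,
    where \<open>lim\<close> applies.\<close>
  by (intro tendsto_sum tendsto_mult tendsto_const tendsto_prod lim) (auto dest: permutes_in_image)

text \<open>Both matrices may vary: the square-zero case perturbs \<open>A\<close>, the density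
  argument perturbs \<open>X\<close>.\<close>

lemma tendsto_det_anticommutator:
  fixes A X :: "'b \<Rightarrow> real mat"
  assumes A: "\<And>x. A x \<in> carrier_mat n n" and X: "\<And>x. X x \<in> carrier_mat n n"
    and B: "B \<in> carrier_mat n n" and Y: "Y \<in> carrier_mat n n"
    and limA: "\<And>i j. i < n \<Longrightarrow> j < n \<Longrightarrow> ((\<lambda>x. A x $$ (i,j)) \<longlongrightarrow> B $$ (i,j)) F"
    and limX: "\<And>i j. i < n \<Longrightarrow> j < n \<Longrightarrow> ((\<lambda>x. X x $$ (i,j)) \<longlongrightarrow> Y $$ (i,j)) F"
  shows "((\<lambda>x. det (A x * X x + X x * A x)) \<longlongrightarrow> det (B * Y + Y * B)) F"
proof (rule tendsto_det)
  fix i j assume ij: "i < n" "j < n"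
  have ent: "(P * Q + Q * P) $$ (i,j) = (\<Sum>k<n. P $$ (i,k) * Q $$ (k,j)) + (\<Sum>k<n. Q $$ (i,k) * P $$ (k,j))"
    if "P \<in> carrier_mat n n" "Q \<in> carrier_mat n n" for P Q :: "real mat"
    using that ij by (simp add: scalar_prod_def atLeast0LessThan)
  show "((\<lambda>x. (A x * X x + X x * A x) $$ (i,j)) \<longlongrightarrow> (B * Y + Y * B) $$ (i,j)) F"
    unfolding ent[OF A X] ent[OF B Y]
    by (intro tendsto_intros limA limX) (use ij in auto)
next
  show "A x * X x + X x * A x \<in> carrier_mat n n" for x
    using mult_carrier_mat[OF A X] mult_carrier_mat[OF X A] by simp
qed (use B Y in simp)

lemma add_mat_eq_self_imp_0:
  fixes P :: "'a::ab_group_add mat"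
  assumes "P \<in> carrier_mat n m" "Q \<in> carrier_mat n m" and eq: "P = P + Q"
  shows "Q = 0\<^sub>m n m"
proof (rule eq_matI)
  fix i j assume ij: "i < dim_row (0\<^sub>m n m :: 'a mat)" "j < dim_col (0\<^sub>m n m :: 'a mat)"
  then have "P $$ (i,j) = P $$ (i,j) + Q $$ (i,j)"
    using arg_cong[OF eq, of "\<lambda>M. M $$ (i,j)"] assms(1,2) by simp
  then show "Q $$ (i,j) = 0\<^sub>m n m $$ (i,j)" using ij by simp
qed (use assms in auto)

text \<open>If \<open>M\<close> is invertible, its inverse \<open>N\<close> commutes with
  \<open>A\<close> because \<open>M\<close> does, so \<open>Y = X * N\<close> satisfies
  \<open>A * Y + Y * A = 1\<close>. From \<open>Y\<close> comes a direction \<open>Z\<close> along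
  which \<open>A\<close> can be perturbed into matrices with negative scalar square, and
  nonnegativity passes to the limit.\<close>

lemma det_anticommutator_nonneg_of_square_0:
  fixes A :: "real mat"
  assumes A: "A \<in> carrier_mat n n" and X: "X \<in> carrier_mat n n" and AA: "A * A = 0\<^sub>m n n"
  shows "0 \<le> det (A * X + X * A)"
proof (cases "det (A * X + X * A) = 0")
  case False
  define M where "M = A * X + X * A"
  have M: "M \<in> carrier_mat n n" using A X by (simp add: M_def)
  obtain N where N: "N \<in> carrier_mat n n" "M * N = 1\<^sub>m n" "N * M = 1\<^sub>m n"
    using nonsingular_inverse[OF M] False M_def by blast
  have MA: "M * A = A * M"
    unfolding M_def by (rule anticommutator_commute[OF A X, of 0]) (use AA in \<open>auto intro!: eq_matI\<close>)
  have NA: "N * A = A * N"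
  proof -
    have "N * A = N * (A * (M * N))" using N A by simp
    also have "\<dots> = N * (A * M) * N" using N(1) M A by (simp add: assoc_mult_mat[of _ n n _ n _ n])
    also have "\<dots> = N * M * (A * N)"
      unfolding MA[symmetric] using N(1) M A by (simp add: assoc_mult_mat[of _ n n _ n _ n])
    also have "\<dots> = A * N" using N A by simp
    finally show ?thesis .
  qed
  define Y where "Y = X * N"
  have Y: "Y \<in> carrier_mat n n" using X N by (simp add: Y_def)
  have AYA: "A * Y + Y * A = 1\<^sub>m n"
  proof -
    have "Y * A = X * (A * N)" unfolding Y_def NA[symmetric] using X N A by simp
    then have "A * Y + Y * A = M * N"
      using A X N(1) by (simp add: M_def Y_def add_mult_distrib_mat[of _ n n _ _ n])
    then show ?thesis using N by simp
  qed
  have A0: "A * (A * Z) = 0\<^sub>m n n" if "Z \<in> carrier_mat n n" for Z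
    using assoc_mult_mat[OF A A that] AA that by simp
  have AYA': "A * (Y * A) = A"
  proof -
    have "A * (A * Y + Y * A) = A * (Y * A)"
      using A Y A0[OF Y] by (simp add: mult_add_distrib_mat[of _ n n _ n])
    then show ?thesis using AYA A by simp
  qed
  \<comment> \<open>\<open>Y\<close> is a homotopy contracting \<open>A\<close>; replacing it by \<open>Y A Y\<close> makes it square to zero as well,
    so that \<open>(A + e Z)\<^sup>2 = e I\<close>.\<close>
  define Z where "Z = Y * (A * Y)"
  have Z: "Z \<in> carrier_mat n n" using A Y by (simp add: Z_def)
  have YA: "Y * A \<in> carrier_mat n n" and AY: "A * Y \<in> carrier_mat n n" using A Y by auto
  have AZ: "A * Z = A * Y"
    using assoc_mult_mat[OF A Y, of "A * Y" n] assoc_mult_mat[OF A YA Y] assoc_mult_mat[OF Y A Y] AYA' A Y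
    by (simp add: Z_def)
  have ZA: "Z * A = Y * A"
    using AYA' A Y by (simp add: Z_def assoc_mult_mat[of _ n n _ n _ n])
  have AZA: "A * Z + Z * A = 1\<^sub>m n" using AZ ZA AYA by simp
  \<comment> \<open>Multiplying \<open>A * Z + Z * A = 1\<close> by \<open>Z\<close> on the left and
    using \<open>Z * (A * Z) = Z\<close> gives \<open>Z * (Z * A) = 0\<close>; then
    \<open>Z * Z = Z * (Z * A) * Z\<close> vanishes.\<close>
  have ZZ: "Z * Z = 0\<^sub>m n n"
  proof -
    have "Z * (A * Z + Z * A) = Z * (A * Z) + Z * Z * A"
      using A Z by (simp add: mult_add_distrib_mat[of _ n n _ n])
    have "Z * (A * Z) = Z" 
    proof -
      have "Z * (A * Z) = (Z * A) * Z" using A Z by simp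
      also have "\<dots> = Y * (A * Z)" unfolding ZA using A Y Z by simp
      also have "\<dots> = Z" unfolding AZ by (rule Z_def[symmetric])
      finally show ?thesis .
    qed
    then have "Z = Z + Z * (Z * A)"
      using \<open>Z * (A * Z + Z * A) = _\<close> AZA Z A by (simp add: assoc_mult_mat[of _ n n _ n _ n])
    then have ZZA: "Z * (Z * A) = 0\<^sub>m n n" using Z A by (intro add_mat_eq_self_imp_0[of Z n n]) simp_all
    have "Z * Z = Z * (Z * (A * Z))" using \<open>Z * (A * Z) = Z\<close> by simp
    also have "\<dots> = Z * (Z * A) * Z" using Z A by (simp add: assoc_mult_mat[of _ n n _ n _ n])
    also have "\<dots> = 0\<^sub>m n n" unfolding ZZA using Z by simp
    finally show ?thesis .
  qed
  \<comment> \<open>The coefficient is negative so that the square of \<open>B k\<close> is a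
    negative scalar; \<open>Suc k\<close> keeps it nonzero at \<open>k = 0\<close>.\<close>
  define B where "B k = A + (- inverse (real (Suc k))) \<cdot>\<^sub>m Z" for k
  have B: "B k \<in> carrier_mat n n" for k using A Z by (simp add: B_def)
  have "0 \<le> det (B k * X + X * B k)" for k
  proof (rule det_anticommutator_nonneg_of_square_neg[OF B X])
    define e where "e = - inverse (real (Suc k))"
    show "e < 0" by (simp add: e_def)
    have eZ: "e \<cdot>\<^sub>m Z \<in> carrier_mat n n" using Z by simp
    have "B k * B k = A * A + A * (e \<cdot>\<^sub>m Z) + ((e \<cdot>\<^sub>m Z) * A + (e \<cdot>\<^sub>m Z) * (e \<cdot>\<^sub>m Z))"
      unfolding B_def e_def[symmetric]
      unfolding add_mult_distrib_mat[OF A eZ add_carrier_mat[OF eZ]]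
        mult_add_distrib_mat[OF A A eZ] mult_add_distrib_mat[OF eZ A eZ] ..
    also have "\<dots> = e \<cdot>\<^sub>m (A * Z + Z * A)"
      using A Z ZZ AA by (simp add: mult_smult_distrib[of _ n n _ n] mult_smult_assoc_mat[of _ n n _ n] add_smult_distrib_left_mat[of _ n n])
    finally show "B k * B k = e \<cdot>\<^sub>m 1\<^sub>m n" unfolding AZA .
  qed
  moreover have "(\<lambda>k. det (B k * X + X * B k)) \<longlonglongrightarrow> det (A * X + X * A)"
  proof (rule tendsto_det_anticommutator[OF B X A X])
    fix i j assume ij: "i < n" "j < n"
    have "(\<lambda>k. A $$ (i,j) + (- inverse (real (Suc k))) * Z $$ (i,j)) \<longlonglongrightarrow> A $$ (i,j) + (- 0) * Z $$ (i,j)"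
      by (intro tendsto_intros LIMSEQ_inverse_real_of_nat)
    then show "(\<lambda>k. B k $$ (i,j)) \<longlonglongrightarrow> A $$ (i,j)" using ij A Z by (simp add: B_def)
  qed simp
  ultimately show ?thesis by (intro LIMSEQ_le_const) auto
qed simp

section \<open>Density of the subfield\<close>

lemma subfield_realE:
  fixes K :: "real set"
  assumes "subfield K (class_ring :: real ring)"
  shows "0 \<in> K" "1 \<in> K" "x \<in> K \<Longrightarrow> y \<in> K \<Longrightarrow> x + y \<in> K" "x \<in> K \<Longrightarrow> y \<in> K \<Longrightarrow> x * y \<in> K"
    "x \<in> K \<Longrightarrow> - x \<in> K" "x \<in> K \<Longrightarrow> inverse x \<in> K"
proof -
  note sub = subringE[OF subfieldE(1)[OF assms], unfolded class_ring_simps]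
  show "0 \<in> K" "1 \<in> K" "x \<in> K \<Longrightarrow> y \<in> K \<Longrightarrow> x + y \<in> K" "x \<in> K \<Longrightarrow> y \<in> K \<Longrightarrow> x * y \<in> K"
    "x \<in> K \<Longrightarrow> - x \<in> K"
    using sub(2,3,5,6,7) by auto
  have "ring (class_ring :: real ring)" using class_field by (auto simp: field_def domain_def cring_def)
  note inv = ring.subfield_m_inv(1)[OF this assms, unfolded class_ring_simps, of x]
  show "inverse x \<in> K" if "x \<in> K"
    \<comment> \<open>The algebraic inverse law covers only nonzero elements; for zero,
      \<open>inverse 0 = 0\<close> is in \<open>K\<close> already.\<close>
    using that inv by (cases "x = 0") auto
qed

lemma Rats_subset_subfield_real:
  assumes K: "subfield K (class_ring :: real ring)"
  shows "\<rat> \<subseteq> K"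
proof
  fix x :: real assume "x \<in> \<rat>"
  then obtain a b where x: "x = of_int a / of_int b" by (auto elim: Rats_cases')
  have nat: "real m \<in> K" for m
    by (induction m) (auto intro: subfield_realE[OF K] simp: add.commute)
  have int: "real_of_int i \<in> K" for i
    by (cases i) (use nat subfield_realE(5)[OF K] in \<open>auto simp del: of_nat_Suc\<close>)
  show "x \<in> K" unfolding x divide_inverse
    by (intro subfield_realE(4,6)[OF K] int)
qed

lemma rational_approximation:
  fixes x :: real
  obtains q where "\<And>k. q k \<in> \<rat>" "q \<longlonglongrightarrow> x"
proof -
  have "\<exists>q\<in>\<rat>. x < q \<and> q < x + inverse (real (Suc k))" for k
    by (rule Rats_dense_in_real) simp
  then obtain q where q: "\<And>k. q k \<in> \<rat>" "\<And>k. x < q k" "\<And>k. q k < x + inverse (real (Suc k))"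
    by metis
  have "(\<lambda>k. x + inverse (real (Suc k))) \<longlonglongrightarrow> x + 0"
    by (intro tendsto_intros LIMSEQ_inverse_real_of_nat)
  then have "q \<longlonglongrightarrow> x"
    by (intro tendsto_sandwich[of "\<lambda>_. x" q _ "\<lambda>k. x + inverse (real (Suc k))"])
      (use q in \<open>auto intro!: always_eventually less_imp_le\<close>)
  with q(1) that show ?thesis by blast
qed

text \<open>Rational matrices have entries in \<open>K\<close> and approximate every real
  \<open>X\<close> entrywise, and the determinant is continuous.\<close>

lemma det_anticommutator_nonneg_extend:
  assumes K: "subfield K (class_ring :: real ring)" and A: "A \<in> carrier_mat n n"
    and nonneg: "\<forall>X\<in>mats_over n K. 0 \<le> det (A * X + X * A)" and X: "X \<in> carrier_mat n n"
  shows "0 \<le> det (A * X + X * A)"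
proof -
  have "\<exists>q. (\<forall>k. q k \<in> \<rat>) \<and> q \<longlonglongrightarrow> X $$ (i,j)" for i j
    using rational_approximation by metis
  then obtain q where q: "\<And>i j k. q i j k \<in> \<rat>" "\<And>i j. q i j \<longlonglongrightarrow> X $$ (i,j)"
    by metis
  define Q where "Q k = mat n n (\<lambda>(i,j). q i j k)" for k :: nat
  have Q: "Q k \<in> carrier_mat n n" for k by (simp add: Q_def)
  have "Q k \<in> mats_over n K" for k
    using q(1) Rats_subset_subfield_real[OF K] by (auto simp: mats_over_def Q_def elements_mat_def)
  then have "0 \<le> det (A * Q k + Q k * A)" for k using nonneg by blast
  moreover have "(\<lambda>k. det (A * Q k + Q k * A)) \<longlonglongrightarrow> det (A * X + X * A)"
    by (rule tendsto_det_anticommutator[OF A Q A X]) (use q in \<open>auto simp: Q_def\<close>)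
  ultimately show ?thesis by (intro LIMSEQ_le_const) auto
qed

section \<open>Both implications, and descent of the scalar from the reals to
  \<open>K\<close>\<close>

theorem theorem2:
  fixes K :: "real set" and n :: nat and A :: "real mat"
  assumes "subfield K (class_ring :: real ring)"
    and "n \<ge> 2" and "even n"
    and "A \<in> mats_over n K"
  shows "(\<forall>X \<in> mats_over n K. det (A * X + X * A) \<ge> 0) \<longleftrightarrow>
    (real (vec_space.rank n A) < real n / 2 \<or>
      (\<exists>\<alpha> \<in> K. \<alpha> \<le> 0 \<and> A ^\<^sub>m 2 = \<alpha> \<cdot>\<^sub>m 1\<^sub>m n))"
proof -
  have A: "A \<in> carrier_mat n n" using assms(4) by (simp add: mats_over_def)
  have sq: "A ^\<^sub>m 2 = A * A" using A by (simp add: numeral_2_eq_2)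
  show ?thesis
  proof (intro iffI ballI)
    fix X assume "real (vec_space.rank n A) < real n / 2 \<or> (\<exists>\<alpha>\<in>K. \<alpha> \<le> 0 \<and> A ^\<^sub>m 2 = \<alpha> \<cdot>\<^sub>m 1\<^sub>m n)"
      and "X \<in> mats_over n K"
    then have X: "X \<in> carrier_mat n n" by (simp add: mats_over_def)
    \<comment> \<open>A zero scalar is separated because rescaling \<open>A\<close> to a complex
      structure requires a negative one.\<close>
    consider "2 * vec_space.rank n A < n" | \<alpha> where "\<alpha> < 0" "A * A = \<alpha> \<cdot>\<^sub>m 1\<^sub>m n"
      | "A * A = 0 \<cdot>\<^sub>m 1\<^sub>m n"
      using \<open>_ \<or> _\<close> unfolding sq by (fastforce simp: order.order_iff_strict)
    then show "0 \<le> det (A * X + X * A)"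
    proof cases
      case 1
      then show ?thesis using vec_space.det_anticommutator_low_rank[OF A X] by simp
    next
      case 2
      then show ?thesis using det_anticommutator_nonneg_of_square_neg[OF A X] by blast
    next
      case 3
      then have "A * A = 0\<^sub>m n n" by (auto intro!: eq_matI)
      then show ?thesis using det_anticommutator_nonneg_of_square_0[OF A X] by blast
    qed
  next
    assume nn: "\<forall>X \<in> mats_over n K. det (A * X + X * A) \<ge> 0"
    show "real (vec_space.rank n A) < real n / 2 \<or> (\<exists>\<alpha>\<in>K. \<alpha> \<le> 0 \<and> A ^\<^sub>m 2 = \<alpha> \<cdot>\<^sub>m 1\<^sub>m n)"
    proof (rule disjCI)
      assume neg: "\<not> (\<exists>\<alpha>\<in>K. \<alpha> \<le> 0 \<and> A ^\<^sub>m 2 = \<alpha> \<cdot>\<^sub>m 1\<^sub>m n)"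
      show "real (vec_space.rank n A) < real n / 2"
      proof (rule ccontr)
        assume "\<not> ?thesis"
        then have "n \<le> 2 * vec_space.rank n A" by simp
        then obtain X where X: "X \<in> carrier_mat n n" "det (A * X + X * A) \<noteq> 0"
          using exists_det_anticommutator_ne_0[OF A] by blast
        obtain \<alpha> where \<alpha>: "\<alpha> \<le> 0" "A * A = \<alpha> \<cdot>\<^sub>m 1\<^sub>m n"
          using square_scalar_of_det_anticommutator_nonneg[OF A _ det_anticommutator_nonneg_extend[OF assms(1) A nn] X]
            assms(2) by auto
        have "A $$ (i,j) \<in> K" if "i < n" "j < n" for i j
          using assms(4) that by (auto simp: mats_over_def)
        \<comment> \<open>The real argument only yields a real \<open>\<alpha>\<close>. It is the
          top left entry of \<open>A * A\<close>, a sum of products of entries of \<open>A\<close>;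
          induction on partial sums keeps it in \<open>K\<close>.\<close>
        then have "(\<Sum>k<m. A $$ (0,k) * A $$ (k,0)) \<in> K" if "m \<le> n" for m
          using that assms(2) by (induction m) (auto intro!: subfield_realE[OF assms(1)])
        moreover have "(A * A) $$ (0,0) = (\<Sum>k<n. A $$ (0,k) * A $$ (k,0))"
          using A assms(2) by (simp add: scalar_prod_def atLeast0LessThan)
        ultimately have "(A * A) $$ (0,0) \<in> K" by simp
        then have "\<alpha> \<in> K" using assms(2) unfolding \<alpha>(2) by simp
        with \<alpha> neg sq show False by auto
      qed
    qed
  qed
qed

end
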